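(* Let $K$ be a field, let $\nu$ be a valuation on $K[x]$, and let $\mu$ be a valuation on $K[x]$ with values in $\Gamma_\nu$ such that $\mu<\nu$. Let $\phi\in\mathrm{KP}(\mu)$ be a MLV key polynomial for $\mu$. Then $\phi$ is a key polynomial for $\nu$ if and only if it satisfies one of the following two conditions: (1) $\phi\in\Phi_{\mu,\nu}$; (2) $\phi\notin\Phi_{\mu,\nu}$ and $\deg(\phi)=\deg(\mu)$. In the first case, $\nu_\phi=[\mu;\phi,\nu(\phi)]$. In the second case, $\nu_\phi=\mu$.
   Context: Valuations. A valuation $\nu$ on $K[x]$ is a map $\nu\colon K[x]\to\Lambda\cup\{\infty\}$ ($\Lambda$ a totally ordered abelian group) with $\nu(fg)=\nu(f)+\nu(g)$, $\nu(f+g)\ge\min\{\nu(f),\nu(g)\}$, whose restriction to $K$ is a valuation of the field $K$; non-zero polynomials may have value $\infty$. Its value group $\Gamma_\nu$ is generated by the finite values of $\nu$; $(\Gamma_\nu)_{\mathbb Q}=\Gamma_\nu\otimes\mathbb Q$. $\mu\le\nu$ means $\mu(f)\le\nu(f)$ for all $f\in K[x]$; $\mu<\nu$ means $\mu\le\nu$ and $\mu\ne\nu$. MLV key polynomials. Let $\mathcal P_\alpha=\{g:\mu(g)\ge\alpha\}\supset\mathcal P_\alpha^+=\{g:\mu(g)>\alpha\}$, and let $\mathcal G_\mu=\bigoplus_{\alpha\in\Gamma_\mu}\mathcal P_\alpha/\mathcal P_\alpha^+$ be the graded algebra, with $\operatorname{in}_\mu g=g+\mathcal P_{\mu(g)}^+$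 if $\mu(g)<\infty$, and $\operatorname{in}_\mu g=0$ otherwise. Write $h\mid_\mu g$ if $\operatorname{in}_\mu h$ divides $\operatorname{in}_\mu g$ in $\mathcal G_\mu$. A MacLane-Vaquié (MLV) key polynomial for $\mu$ is a monic $g\in K[x]$ such that $(\operatorname{in}_\mu g)\mathcal G_\mu$ is a non-zero prime ideal and $g\nmid_\mu f$ for every non-zero $f$ with $\deg f<\deg g$. The set of these is $\mathrm{KP}(\mu)$; if non-empty, $\deg(\mu)$ is the minimal degree of an element of $\mathrm{KP}(\mu)$. $\Phi_{\mu,\nu}$ is the set of all monic polynomials $\phi$ of minimal degree among those satisfying $\mu(\phi)<\nu(\phi)$. Truncation and augmentation. For a monic non-constant $Q$ and $f=\sum_s a_sQ^s$ with $\deg a_s<\deg Q$, $\nu_Q(f)=\min_s\nu(a_sQ^s)$. For $\phi\in\mathrm{KP}(\mu)$ and $\gamma>\mu(\phi)$ (possibly $\gamma=\infty$), $[\mu;\phi,\gamma]$ is the valuation $\sum_s a_s\phi^s\mapsto\min_s\{\mu(a_s)+s\gamma\}$ ($\deg a_s<\deg\phi$). (Abstract) key polynomials. For $b\ge0$, $\partial_b$ is defined by $f(x+y)=\sum_{b\ge0}\partial_b(f)y^b$. For non-constant $f$ with $\nu(f)<\infty$ set $\epsilon(f)=\max_{b\ge1}\frac{\nu(f)-\nu(\partial_b(f))}{b}\in(\Gamma_\nu)_{\mathbb Q}$; set $\epsilon(f)=\infty$ if $\nu(f)=\infty$. A monic (non-constant) $Q\in K[x]$ is a key polynomial for $\nu$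 if $0<\deg f<\deg Q$ implies $\epsilon(f)<\epsilon(Q)$, for all $f\in K[x]$. *)

theory Defs
  imports
    "HOL-Library.Extended"
    "HOL-Library.Set_Algebras"
    "HOL-Library.FuncSet"
    "HOL-Library.Poly_Mapping"
    "HOL-Computational_Algebra.Polynomial"
    "HOL-Computational_Algebra.Group_Closure"
    "HOL-Algebra.Ideal"
    "HOL-Algebra.Divisibility"
begin

section \<open>Divisible hull of a totally ordered abelian group\<close>

definition nsmul :: "nat \<Rightarrow> 'a::comm_monoid_add \<Rightarrow> 'a"
  where "nsmul n x = (\<Sum>i<n. x)"

lemma nsmul_0 [simp]: "nsmul 0 x = 0"
  and nsmul_Suc [simp]: "nsmul (Suc n) x = nsmul n x + x"
  by (simp_all add: nsmul_def)

lemma nsmul_zero_right [simp]: "nsmul n 0 = 0"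
  by (simp add: nsmul_def)

lemma nsmul_add: "nsmul n (x + y) = nsmul n x + nsmul n y"
  by (simp add: nsmul_def sum.distrib)

lemma nsmul_minus: "nsmul n (- x :: 'a::ab_group_add) = - nsmul n x"
  by (simp add: nsmul_def sum_negf)

lemma nsmul_plus: "nsmul (m + n) x = nsmul m x + nsmul n x"
  by (induction n) (simp_all add: add.assoc)

lemma nsmul_nsmul: "nsmul m (nsmul n x) = nsmul (m * n) x"
  by (induction m) (simp_all add: nsmul_plus add.commute)

lemma nsmul_le_iff:
  fixes x y :: "'a::linordered_ab_group_add"
  assumes "n \<noteq> 0"
  shows "nsmul n x \<le> nsmul n y \<longleftrightarrow> x \<le> y"
proof
  show "x \<le> y \<Longrightarrow> nsmul n x \<le> nsmul n y"
    by (simp add: nsmul_def sum_mono)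
  show "x \<le> y" if "nsmul n x \<le> nsmul n y"
  proof (rule ccontr)
    assume "\<not> x \<le> y"
    then have "nsmul n y < nsmul n x"
      unfolding nsmul_def using assms by (intro sum_strict_mono) (auto simp: lessThan_empty_iff)
    with that show False by simp
  qed
qed

lemma nsmul_eq_iff:
  fixes x y :: "'a::linordered_ab_group_add"
  shows "n \<noteq> 0 \<Longrightarrow> nsmul n x = nsmul n y \<longleftrightarrow> x = y"
  by (metis nsmul_le_iff order_antisym order_refl)

text \<open>
  The group \<open>\<Lambda> \<otimes> \<rat>\<close>, for a totally ordered (hence torsion-free) group \<open>\<Lambda>\<close>, consists of fractions
  \<open>x / n\<close> with \<open>x \<in> \<Lambda>\<close> and \<open>n > 0\<close>. It contains \<open>\<Gamma> \<otimes> \<rat>\<close> for every subgroup \<open>\<Gamma>\<close> of \<open>\<Lambda>\<close>.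
\<close>

definition dhull_rel :: "'a::linordered_ab_group_add \<times> nat \<Rightarrow> 'a \<times> nat \<Rightarrow> bool"
  where "dhull_rel = (\<lambda>(x, m) (y, n). m \<noteq> 0 \<and> n \<noteq> 0 \<and> nsmul n x = nsmul m y)"

lemma dhull_rel_iff [simp]:
  "dhull_rel a b \<longleftrightarrow> snd a \<noteq> 0 \<and> snd b \<noteq> 0 \<and> nsmul (snd b) (fst a) = nsmul (snd a) (fst b)"
  by (cases a; cases b) (simp add: dhull_rel_def)

lemma part_equivp_dhull_rel: "part_equivp (dhull_rel :: 'a::linordered_ab_group_add \<times> nat \<Rightarrow> _)"
proof (rule part_equivpI)
  show "\<exists>a :: 'a \<times> nat. dhull_rel a a"
    by (rule exI [of _ "(0, 1)"]) simp
  show "symp (dhull_rel :: 'a \<times> nat \<Rightarrow> _)"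
    by (rule sympI) auto
  show "transp (dhull_rel :: 'a \<times> nat \<Rightarrow> _)"
  proof (rule transpI)
    fix a b c :: "'a \<times> nat"
    assume ab: "dhull_rel a b" and bc: "dhull_rel b c"
    obtain x k y m z n where e: "a = (x, k)" "b = (y, m)" "c = (z, n)"
      by (metis surj_pair)
    have "nsmul m (nsmul n x) = nsmul n (nsmul m x)" by (simp add: nsmul_nsmul mult.commute)
    also have "\<dots> = nsmul n (nsmul k y)" using ab e by simp
    also have "\<dots> = nsmul k (nsmul n y)" by (simp add: nsmul_nsmul mult.commute)
    also have "\<dots> = nsmul k (nsmul m z)" using bc e by simp
    also have "\<dots> = nsmul m (nsmul k z)" by (simp add: nsmul_nsmul mult.commute)
    finally show "dhull_rel a c" using ab bc e nsmul_eq_iff by auto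
  qed
qed

quotient_type (overloaded) 'a dhull = "'a::linordered_ab_group_add \<times> nat" / partial: "dhull_rel"
  by (rule part_equivp_dhull_rel)

instantiation dhull :: (linordered_ab_group_add) linorder
begin

lift_definition less_eq_dhull :: "'a dhull \<Rightarrow> 'a dhull \<Rightarrow> bool"
  is "\<lambda>a b. nsmul (snd b) (fst a) \<le> nsmul (snd a) (fst b)"
proof -
  fix a a' b b' :: "'a \<times> nat"
  assume "dhull_rel a a'" and "dhull_rel b b'"
  moreover obtain x k x' k' y m y' m' where
    e: "a = (x, k)" "a' = (x', k')" "b = (y, m)" "b' = (y', m')"
    by (metis surj_pair)
  ultimately have nz: "k \<noteq> 0" "k' \<noteq> 0" "m \<noteq> 0" "m' \<noteq> 0"
    and x: "nsmul k' x = nsmul k x'" and y: "nsmul m' y = nsmul m y'" by auto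
  have "nsmul m x \<le> nsmul k y \<longleftrightarrow> nsmul (m' * k') (nsmul m x) \<le> nsmul (m' * k') (nsmul k y)"
    using nz by (simp add: nsmul_le_iff)
  also have "nsmul (m' * k') (nsmul m x) = nsmul (m' * m) (nsmul k' x)"
    by (simp add: nsmul_nsmul ac_simps)
  also have "\<dots> = nsmul (m * k) (nsmul m' x')"
    by (simp add: x nsmul_nsmul ac_simps)
  also have "nsmul (m' * k') (nsmul k y) = nsmul (k * k') (nsmul m' y)"
    by (simp add: nsmul_nsmul ac_simps)
  also have "\<dots> = nsmul (m * k) (nsmul k' y')"
    by (simp add: y nsmul_nsmul ac_simps)
  also have "nsmul (m * k) (nsmul m' x') \<le> nsmul (m * k) (nsmul k' y') \<longleftrightarrow> nsmul m' x' \<le> nsmul k' y'"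
    using nz by (simp add: nsmul_le_iff)
  finally show "(nsmul (snd b) (fst a) \<le> nsmul (snd a) (fst b)) =
      (nsmul (snd b') (fst a') \<le> nsmul (snd a') (fst b'))"
    by (simp add: e)
qed

definition less_dhull :: "'a dhull \<Rightarrow> 'a dhull \<Rightarrow> bool"
  where "less_dhull a b \<longleftrightarrow> a \<le> b \<and> \<not> b \<le> a"

instance
proof
  fix a b c :: "'a dhull"
  show "a < b \<longleftrightarrow> a \<le> b \<and> \<not> b \<le> a" by (rule less_dhull_def)
  show "a \<le> a" by transfer simp
  show "a \<le> b \<Longrightarrow> b \<le> a \<Longrightarrow> a = b" by transfer auto
  show "a \<le> b \<or> b \<le> a" by transfer auto
  show "a \<le> b \<Longrightarrow> b \<le> c \<Longrightarrow> a \<le> c"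
  proof transfer
    fix a b c :: "'a \<times> nat"
    assume "dhull_rel a a" "dhull_rel b b" "dhull_rel c c"
      and ab: "nsmul (snd b) (fst a) \<le> nsmul (snd a) (fst b)"
      and bc: "nsmul (snd c) (fst b) \<le> nsmul (snd b) (fst c)"
    then have nz: "snd a \<noteq> 0" "snd b \<noteq> 0" "snd c \<noteq> 0" by auto
    have "nsmul (snd b) (nsmul (snd c) (fst a)) = nsmul (snd c) (nsmul (snd b) (fst a))"
      by (simp add: nsmul_nsmul mult.commute)
    also have "\<dots> \<le> nsmul (snd c) (nsmul (snd a) (fst b))"
      using ab nz by (simp add: nsmul_le_iff)
    also have "\<dots> = nsmul (snd a) (nsmul (snd c) (fst b))"
      by (simp add: nsmul_nsmul mult.commute)
    also have "\<dots> \<le> nsmul (snd a) (nsmul (snd b) (fst c))"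
      using bc nz by (simp add: nsmul_le_iff)
    also have "\<dots> = nsmul (snd b) (nsmul (snd a) (fst c))"
      by (simp add: nsmul_nsmul mult.commute)
    finally show "nsmul (snd c) (fst a) \<le> nsmul (snd a) (fst c)"
      using nz by (simp add: nsmul_le_iff)
  qed
qed

end

text \<open>The element \<open>x / n\<close>; the value for \<open>n = 0\<close> is a dummy.\<close>

lift_definition dhull_frac :: "'a::linordered_ab_group_add \<Rightarrow> nat \<Rightarrow> 'a dhull"
  is "\<lambda>x n. if n = 0 then (0, 1) else (x, n)"
  by auto

lemma dhull_frac_le_iff:
  "m \<noteq> 0 \<Longrightarrow> n \<noteq> 0 \<Longrightarrow> dhull_frac x m \<le> dhull_frac y n \<longleftrightarrow> nsmul n x \<le> nsmul m y"
  by transfer simp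


section \<open>Valuations on \<open>K[x]\<close>\<close>

text \<open>
  The codomain \<open>\<Lambda> \<union> {\<infinity>}\<close> is embedded in \<open>'g extended\<close>, which has a further element \<open>-\<infinity>\<close> that a
  valuation never takes. On \<open>K\<close> only \<open>0\<close> has value \<open>\<infinity>\<close>, while non-constant polynomials may have
  value \<open>\<infinity>\<close>.
\<close>

definition is_valuation :: "('k::field poly \<Rightarrow> 'g::linordered_ab_group_add extended) \<Rightarrow> bool"
  where "is_valuation v \<longleftrightarrow>
    (\<forall>f. v f \<noteq> -\<infinity>) \<and>
    (\<forall>f g. v (f * g) = v f + v g) \<and>
    (\<forall>f g. min (v f) (v g) \<le> v (f + g)) \<and>
    (\<forall>c. v [:c:] = \<infinity> \<longleftrightarrow> c = 0)"

definition value_group :: "('k::field poly \<Rightarrow> 'g::linordered_ab_group_add extended) \<Rightarrow> 'g set"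
  where "value_group v = group_closure {a. \<exists>f. v f = Fin a}"


section \<open>Graded algebra and MacLane--Vaquie key polynomials\<close>

definition P_ge :: "('k::field poly \<Rightarrow> 'g::linordered_ab_group_add extended) \<Rightarrow> 'g \<Rightarrow> 'k poly set"
  where "P_ge v a = {g. Fin a \<le> v g}"

definition P_gt :: "('k::field poly \<Rightarrow> 'g::linordered_ab_group_add extended) \<Rightarrow> 'g \<Rightarrow> 'k poly set"
  where "P_gt v a = {g. Fin a < v g}"

text \<open>
  An element of \<open>\<Oplus>\<^sub>a P_ge v a / P_gt v a\<close> is a family of cosets, indexed by the value group, of which
  only finitely many differ from the zero coset \<open>P_gt v a\<close>. Sums and products of cosets are those of
  sets; a product of cosets in degrees \<open>a\<close> and \<open>b\<close> is contained in a coset in degree \<open>a + b\<close>, and adding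
  \<open>P_gt v (a + b)\<close> yields that coset.
\<close>

definition initial_form ::
    "('k::field poly \<Rightarrow> 'g::linordered_ab_group_add extended) \<Rightarrow> 'k poly \<Rightarrow> 'g \<Rightarrow> 'k poly set"
  where "initial_form v g = (\<lambda>a \<in> value_group v. if v g = Fin a then g +o P_gt v a else P_gt v a)"

definition graded_algebra ::
    "('k::field poly \<Rightarrow> 'g::linordered_ab_group_add extended) \<Rightarrow> ('g \<Rightarrow> 'k poly set) ring"
  where "graded_algebra v =
    \<lparr>carrier = {F \<in> (\<Pi>\<^sub>E a \<in> value_group v. (\<lambda>g. g +o P_gt v a) ` P_ge v a).
        finite {a \<in> value_group v. F a \<noteq> P_gt v a}},
     mult = (\<lambda>F G. \<lambda>c \<in> value_group v.
        (\<Sum>a \<in> {a \<in> value_group v. F a \<noteq> P_gt v a}. F a * G (c - a)) + P_gt v c),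
     one = initial_form v 1,
     zero = (\<lambda>a \<in> value_group v. P_gt v a),
     add = (\<lambda>F G. \<lambda>a \<in> value_group v. F a + G a)\<rparr>"

definition in_dvd ::
    "('k::field poly \<Rightarrow> 'g::linordered_ab_group_add extended) \<Rightarrow> 'k poly \<Rightarrow> 'k poly \<Rightarrow> bool"
  where "in_dvd v h g \<longleftrightarrow> initial_form v h divides\<^bsub>graded_algebra v\<^esub> initial_form v g"

definition KP :: "('k::field poly \<Rightarrow> 'g::linordered_ab_group_add extended) \<Rightarrow> 'k poly set"
  where "KP v = {g. lead_coeff g = 1 \<and>
     primeideal (PIdl\<^bsub>graded_algebra v\<^esub> (initial_form v g)) (graded_algebra v) \<and>
     PIdl\<^bsub>graded_algebra v\<^esub> (initial_form v g) \<noteq> {\<zero>\<^bsub>graded_algebra v\<^esub>} \<and>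
     (\<forall>f. f \<noteq> 0 \<and> degree f < degree g \<longrightarrow> \<not> in_dvd v g f)}"

definition KP_degree :: "('k::field poly \<Rightarrow> 'g::linordered_ab_group_add extended) \<Rightarrow> nat"
  where "KP_degree v = (LEAST n. n \<in> degree ` KP v)"

definition Phi :: "('k::field poly \<Rightarrow> 'g::linordered_ab_group_add extended) \<Rightarrow>
    ('k poly \<Rightarrow> 'g extended) \<Rightarrow> 'k poly set"
  where "Phi u v = {p. lead_coeff p = 1 \<and> u p < v p \<and>
     (\<forall>q. lead_coeff q = 1 \<and> u q < v q \<longrightarrow> degree p \<le> degree q)}"


section \<open>Truncation and augmentation\<close>

text \<open>
  The coefficient \<open>a\<^sub>s\<close> in \<open>f = \<Sum>\<^sub>s a\<^sub>s Q\<^sup>s\<close> with \<open>deg a\<^sub>s < deg Q\<close>, see \<open>expansion_unique\<close> below.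
\<close>

definition expansion_coeff :: "'k::field poly \<Rightarrow> 'k poly \<Rightarrow> nat \<Rightarrow> 'k poly"
  where "expansion_coeff Q f s = (f div Q ^ s) mod Q"

text \<open>As \<open>a\<^sub>s = 0\<close> for \<open>s > deg f\<close>, it suffices to consider \<open>s \<le> deg f\<close> in the following minima.\<close>

definition truncation ::
    "('k::field poly \<Rightarrow> 'g::linordered_ab_group_add extended) \<Rightarrow> 'k poly \<Rightarrow> 'k poly \<Rightarrow> 'g extended"
  where "truncation v Q f = Min ((\<lambda>s. v (expansion_coeff Q f s * Q ^ s)) ` {..degree f})"

definition augmentation ::
    "('k::field poly \<Rightarrow> 'g::linordered_ab_group_add extended) \<Rightarrow> 'k poly \<Rightarrow> 'g extended
      \<Rightarrow> 'k poly \<Rightarrow> 'g extended"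
  where "augmentation u p c f =
    Min ((\<lambda>s. u (expansion_coeff p f s) + nsmul s c) ` {..degree f})"


section \<open>Abstract key polynomials\<close>

text \<open>
  In \<open>K[x][y]\<close> the variable \<open>x\<close> is \<open>[:[:0, 1:]:]\<close> and \<open>y\<close> is \<open>[:0, 1:]\<close>, so \<open>[:[:0, 1:], 1:]\<close> is \<open>x + y\<close>.
\<close>

definition hasse :: "nat \<Rightarrow> 'k::field poly \<Rightarrow> 'k poly"
  where "hasse b f = coeff (pcompose (map_poly (\<lambda>c. [:c:]) f) [:[:0, 1:], 1:]) b"

text \<open>
  The quotient for \<open>b\<close> is \<open>-\<infinity>\<close> if \<open>v (hasse b f) = \<infinity>\<close>, which includes all \<open>b > deg f\<close>. It is finite for
  \<open>b = deg f\<close>, since \<open>hasse (deg f) f\<close> is the leading coefficient of \<open>f\<close>.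
\<close>

definition epsilon ::
    "('k::field poly \<Rightarrow> 'g::linordered_ab_group_add extended) \<Rightarrow> 'k poly \<Rightarrow> 'g dhull extended"
  where "epsilon v f = (if v f = \<infinity> then \<infinity> else
    Max ((\<lambda>b. map_extended (\<lambda>a. dhull_frac a b) (v f - v (hasse b f))) ` {1..degree f}))"

definition key_polynomial ::
    "('k::field poly \<Rightarrow> 'g::linordered_ab_group_add extended) \<Rightarrow> 'k poly \<Rightarrow> bool"
  where "key_polynomial v Q \<longleftrightarrow> lead_coeff Q = 1 \<and> 0 < degree Q \<and>
    (\<forall>f. 0 < degree f \<and> degree f < degree Q \<longrightarrow> epsilon v f < epsilon v Q)"


section \<open>Basic facts\<close>

lemma hasse_eq_0: "degree f < b \<Longrightarrow> hasse b f = 0"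
proof -
  have "degree (map_poly (\<lambda>c. [:c:]) f) = degree f"
    by (rule degree_map_poly) simp
  moreover assume "degree f < b"
  ultimately show ?thesis
    unfolding hasse_def by (intro coeff_eq_0) (simp add: degree_pcompose)
qed

lemma hasse_degree: "hasse (degree f) f = [:lead_coeff f:]"
proof -
  let ?F = "map_poly (\<lambda>c. [:c:]) f"
  have d: "degree ?F = degree f"
    by (rule degree_map_poly) simp
  then have "degree (pcompose ?F [:[:0, 1:], 1:]) = degree f"
    by (simp add: degree_pcompose)
  then have "hasse (degree f) f = lead_coeff (pcompose ?F [:[:0, 1:], 1:])"
    by (simp add: hasse_def)
  also have "\<dots> = lead_coeff ?F"
    by (subst lead_coeff_comp) simp_all
  finally show ?thesis
    by (simp add: d coeff_map_poly)
qed

lemma expansion_exists: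
  fixes f Q :: "'k::field poly"
  assumes "0 < degree Q"
  shows "degree (expansion_coeff Q f s) < degree Q"
    and "degree f < s \<Longrightarrow> expansion_coeff Q f s = 0"
    and "f = (\<Sum>s\<le>degree f. expansion_coeff Q f s * Q ^ s)"
proof -
  have Q: "Q \<noteq> 0" using assms by auto
  show "degree (expansion_coeff Q f s) < degree Q"
    unfolding expansion_coeff_def using assms degree_mod_less'[OF Q]
    by (metis degree_0)
  have big: "f div Q ^ s = 0" if "degree f < s" for s
  proof (rule div_poly_less)
    have "s \<le> degree (Q ^ s)" using assms Q by (simp add: degree_power_eq)
    with that show "degree f < degree (Q ^ s)" by simp
  qed
  then show "degree f < s \<Longrightarrow> expansion_coeff Q f s = 0"
    by (simp add: expansion_coeff_def)
  have "f = (\<Sum>s<n. expansion_coeff Q f s * Q ^ s) + (f div Q ^ n) * Q ^ n" for n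
  proof (induction n)
    case (Suc n)
    have "f div Q ^ Suc n = f div Q ^ n div Q"
      by (metis mult.commute poly_div_mult_right power_Suc)
    then have "f div Q ^ n = (f div Q ^ Suc n) * Q + expansion_coeff Q f n"
      by (simp add: expansion_coeff_def)
    then have "(f div Q ^ n) * Q ^ n =
        (f div Q ^ Suc n) * Q ^ Suc n + expansion_coeff Q f n * Q ^ n"
      by (simp add: algebra_simps)
    with Suc show ?case by (simp add: algebra_simps)
  qed simp
  from this[of "Suc (degree f)"] show "f = (\<Sum>s\<le>degree f. expansion_coeff Q f s * Q ^ s)"
    using big[of "Suc (degree f)"] by (simp add: lessThan_Suc_atMost)
qed

lemma expansion_unique:
  fixes Q :: "'k::field poly"
  assumes "f = (\<Sum>s\<le>n. a s * Q ^ s)" and "\<And>s. degree (a s) < degree Q" and "s \<le> n"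
  shows "expansion_coeff Q f s = a s"
  using assms
proof (induction n arbitrary: f a s)
  case 0
  then show ?case by (simp add: expansion_coeff_def mod_poly_less)
next
  case (Suc n)
  let ?g = "\<Sum>s\<le>n. a (Suc s) * Q ^ s"
  have Q: "Q \<noteq> 0" using Suc.prems(2)[of 0] by auto
  have f: "f = a 0 + Q * ?g"
    unfolding Suc.prems(1) by (subst sum.atMost_Suc_shift) (simp add: sum_distrib_left ac_simps)
  have lo: "a 0 div Q = 0" "a 0 mod Q = a 0"
    using Suc.prems(2)[of 0] by (simp_all add: div_poly_less mod_poly_less)
  have d: "f div Q = ?g" using Q lo by (simp add: f)
  show ?case
  proof (cases s)
    case 0
    then show ?thesis using lo by (simp add: expansion_coeff_def f)
  next
    case (Suc t)
    have "expansion_coeff Q f s = expansion_coeff Q ?g t"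
      by (simp add: expansion_coeff_def Suc poly_div_mult_right d)
    also have "\<dots> = a (Suc t)"
      using Suc.prems Suc by (intro Suc.IH[of _ "\<lambda>s. a (Suc s)"]) auto
    finally show ?thesis by (simp add: Suc)
  qed
qed


subsection \<open>The graded algebra is a commutative ring\<close>

context
  fixes v :: "'k::field poly \<Rightarrow> 'g::linordered_ab_group_add extended"
  assumes v: "is_valuation v"
begin

lemma val_mult: "v (f * g) = v f + v g"
  and val_add: "min (v f) (v g) \<le> v (f + g)"
  and val_not_Minf [simp]: "v f \<noteq> -\<infinity>"
  and val_const: "v [:c:] = \<infinity> \<longleftrightarrow> c = 0"
  using v by (auto simp: is_valuation_def)

lemma val_0 [simp]: "v 0 = \<infinity>"
  using val_const[of 0] by simp

lemma val_1 [simp]: "v 1 = Fin 0"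
proof -
  have "v 1 \<noteq> \<infinity>" using val_const[of 1] by (simp add: one_pCons)
  then obtain a where a: "v 1 = Fin a" using val_not_Minf by (cases "v 1") auto
  with val_mult[of 1 1] show ?thesis by simp
qed

lemma val_minus_1: "v (- 1) = Fin 0"
proof -
  have "v (- 1) \<noteq> \<infinity>" using val_const[of "- 1"] by (simp add: one_pCons)
  then obtain a where a: "v (- 1) = Fin a" using val_not_Minf by (cases "v (- 1)") auto
  with val_mult[of "- 1" "- 1"] have "a + a = 0" by simp
  with a show ?thesis by (simp add: double_zero)
qed

lemma val_uminus: "v (- f) = v f"
  using val_mult[of "- 1" f] val_minus_1 by (cases "v f") auto

lemma P_ge_0 [simp]: "0 \<in> P_ge v a" and P_gt_0 [simp]: "0 \<in> P_gt v a"
  by (simp_all add: P_ge_def P_gt_def)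

lemma P_ge_add: "f \<in> P_ge v a \<Longrightarrow> g \<in> P_ge v a \<Longrightarrow> f + g \<in> P_ge v a"
  and P_gt_add: "f \<in> P_gt v a \<Longrightarrow> g \<in> P_gt v a \<Longrightarrow> f + g \<in> P_gt v a"
  and P_ge_minus: "f \<in> P_ge v a \<Longrightarrow> - f \<in> P_ge v a"
  and P_gt_minus: "f \<in> P_gt v a \<Longrightarrow> - f \<in> P_gt v a"
  and P_gt_imp_ge: "f \<in> P_gt v a \<Longrightarrow> f \<in> P_ge v a"
  using val_add[of f g]
  by (auto simp: P_ge_def P_gt_def val_uminus min_def split: if_splits)

lemma P_gt_diff: "f \<in> P_gt v a \<Longrightarrow> g \<in> P_gt v a \<Longrightarrow> f - g \<in> P_gt v a"
  using P_gt_add[of f a "- g"] P_gt_minus by simp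

lemma P_ge_mult: "f \<in> P_ge v a \<Longrightarrow> g \<in> P_ge v b \<Longrightarrow> f * g \<in> P_ge v (a + b)"
  by (cases "v f"; cases "v g") (auto simp: P_ge_def val_mult add_mono)

lemma P_gt_mult_left: "f \<in> P_gt v a \<Longrightarrow> g \<in> P_ge v b \<Longrightarrow> f * g \<in> P_gt v (a + b)"
  by (cases "v f"; cases "v g") (auto simp: P_ge_def P_gt_def val_mult add_less_le_mono)

lemma P_gt_mult_right: "f \<in> P_ge v a \<Longrightarrow> g \<in> P_gt v b \<Longrightarrow> f * g \<in> P_gt v (a + b)"
  by (cases "v f"; cases "v g") (auto simp: P_ge_def P_gt_def val_mult add_le_less_mono)

lemma mem_coset_iff: "h \<in> f +o P_gt v a \<longleftrightarrow> h - f \<in> P_gt v a"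
  by (force simp: elt_set_plus_def)

lemma coset_eq_iff: "f +o P_gt v a = g +o P_gt v a \<longleftrightarrow> f - g \<in> P_gt v a"
proof
  assume "f +o P_gt v a = g +o P_gt v a"
  then have "f \<in> g +o P_gt v a" using mem_coset_iff[of f f a] by simp
  then show "f - g \<in> P_gt v a" by (simp add: mem_coset_iff)
next
  assume fg: "f - g \<in> P_gt v a"
  show "f +o P_gt v a = g +o P_gt v a"
  proof (rule Set.set_eqI)
    fix h
    show "h \<in> f +o P_gt v a \<longleftrightarrow> h \<in> g +o P_gt v a"
      using P_gt_add[OF _ fg, of "h - f"] P_gt_diff[OF _ fg, of "h - g"]
      by (auto simp: mem_coset_iff)
  qed
qed

lemma coset_zero: "0 +o P_gt v a = P_gt v a"
  by (auto simp: elt_set_plus_def)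

lemma coset_eq_zero_iff: "f +o P_gt v a = P_gt v a \<longleftrightarrow> f \<in> P_gt v a"
  using coset_eq_iff[of f a 0] by (simp add: coset_zero)

lemma coset_add: "(f +o P_gt v a) + (g +o P_gt v a) = (f + g) +o P_gt v a"
proof (rule Set.set_eqI)
  fix h
  show "h \<in> (f +o P_gt v a) + (g +o P_gt v a) \<longleftrightarrow> h \<in> (f + g) +o P_gt v a"
  proof
    assume "h \<in> (f +o P_gt v a) + (g +o P_gt v a)"
    then obtain x y where "h = x + y" "x - f \<in> P_gt v a" "y - g \<in> P_gt v a"
      by (auto simp: set_plus_def mem_coset_iff)
    then show "h \<in> (f + g) +o P_gt v a"
      using P_gt_add[of "x - f" a "y - g"] by (simp add: mem_coset_iff algebra_simps)
  next
    assume "h \<in> (f + g) +o P_gt v a"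
    then have "f \<in> f +o P_gt v a" "h - f \<in> g +o P_gt v a"
      by (simp_all add: mem_coset_iff algebra_simps)
    then have "f + (h - f) \<in> (f +o P_gt v a) + (g +o P_gt v a)" by (rule set_plus_intro)
    then show "h \<in> (f +o P_gt v a) + (g +o P_gt v a)" by simp
  qed
qed

lemma coset_mult_subset:
  assumes "f \<in> P_ge v a" "g \<in> P_ge v b"
  shows "(f +o P_gt v a) * (g +o P_gt v b) \<subseteq> (f * g) +o P_gt v (a + b)"
proof
  fix h assume "h \<in> (f +o P_gt v a) * (g +o P_gt v b)"
  then obtain x y where h: "h = x * y" and x: "x - f \<in> P_gt v a" and y: "y - g \<in> P_gt v b"
    by (auto simp: set_times_def mem_coset_iff)
  have "y \<in> P_ge v b" using P_ge_add[OF P_gt_imp_ge[OF y] assms(2)] by simp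
  then have "(x - f) * y + f * (y - g) \<in> P_gt v (a + b)"
    using x y assms by (intro P_gt_add P_gt_mult_left P_gt_mult_right)
  then show "h \<in> (f * g) +o P_gt v (a + b)"
    by (simp add: mem_coset_iff h algebra_simps)
qed

lemma coset_sum:
  assumes "finite S" "\<And>a. a \<in> S \<Longrightarrow> f a \<in> A a" "\<And>a. a \<in> S \<Longrightarrow> A a \<subseteq> f a +o P_gt v c"
  shows "sum A S + P_gt v c = sum f S +o P_gt v c"
proof -
  have "sum f S \<in> sum A S \<and> sum A S \<subseteq> sum f S +o P_gt v c"
    using assms
  proof (induction S)
    case empty
    then show ?case by (auto simp: mem_coset_iff)
  next
    case (insert a S)
    then have fa: "f a \<in> A a" and Aa: "A a \<subseteq> f a +o P_gt v c"
      and s: "sum f S \<in> sum A S" and sA: "sum A S \<subseteq> sum f S +o P_gt v c" by auto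
    have "A a + sum A S \<subseteq> (f a +o P_gt v c) + (sum f S +o P_gt v c)"
      using Aa sA by (rule set_plus_mono2)
    with fa s insert.hyps show ?case by (auto simp: coset_add)
  qed
  then have *: "sum f S \<in> sum A S" "sum A S \<subseteq> sum f S +o P_gt v c" by auto
  have "sum A S + P_gt v c \<subseteq> (sum f S +o P_gt v c) + (0 +o P_gt v c)"
    using *(2) by (intro set_plus_mono2) (simp_all add: coset_zero)
  then have "sum A S + P_gt v c \<subseteq> sum f S +o P_gt v c" by (simp only: coset_add add_0_right)
  moreover have "sum f S +o P_gt v c \<subseteq> sum A S + P_gt v c"
    using *(1) by (auto simp: elt_set_plus_def)
  ultimately show ?thesis by (rule equalityI)
qed

lemma sum_in_P_ge: "(\<And>a. a \<in> S \<Longrightarrow> f a \<in> P_ge v c) \<Longrightarrow> sum f S \<in> P_ge v c"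
  by (induction S rule: infinite_finite_induct) (auto intro: P_ge_add)

lemma sum_in_P_gt: "(\<And>a. a \<in> S \<Longrightarrow> f a \<in> P_gt v c) \<Longrightarrow> sum f S \<in> P_gt v c"
  by (induction S rule: infinite_finite_induct) (auto intro: P_gt_add)

lemma value_group_0 [simp]: "0 \<in> value_group v"
  and value_group_add: "a \<in> value_group v \<Longrightarrow> b \<in> value_group v \<Longrightarrow> a + b \<in> value_group v"
  and value_group_diff: "a \<in> value_group v \<Longrightarrow> b \<in> value_group v \<Longrightarrow> a - b \<in> value_group v"
  by (simp_all add: value_group_def group_closure_add group_closure.diff)

lemma value_group_base: "v f = Fin a \<Longrightarrow> a \<in> value_group v"
  by (auto simp: value_group_def intro!: group_closure.base)

definition graded_reps :: "('g \<Rightarrow>\<^sub>0 'k poly) set"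
  where "graded_reps = {p. Poly_Mapping.keys p \<subseteq> value_group v \<and> (\<forall>a. Poly_Mapping.lookup p a \<in> P_ge v a)}"

definition graded_proj :: "('g \<Rightarrow>\<^sub>0 'k poly) \<Rightarrow> 'g \<Rightarrow> 'k poly set"
  where "graded_proj p = (\<lambda>a \<in> value_group v. Poly_Mapping.lookup p a +o P_gt v a)"

lemma lookup_mult_keys:
  "Poly_Mapping.lookup (p * q) (c::'g) = (\<Sum>a\<in>Poly_Mapping.keys p. Poly_Mapping.lookup p a * Poly_Mapping.lookup q (c - a))"
proof -
  have "Poly_Mapping.lookup (p * q) c = (\<Sum>a. Poly_Mapping.lookup p a * (\<Sum>b. Poly_Mapping.lookup q b when c = a + b))"
    by (simp add: lookup_mult)
  also have "\<dots> = (\<Sum>a. Poly_Mapping.lookup p a * Poly_Mapping.lookup q (c - a))"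
  proof (rule Sum_any.cong)
    fix a
    have eq: "(\<lambda>b. Poly_Mapping.lookup q b when c = a + b) = (\<lambda>b. Poly_Mapping.lookup q b when b = c - a)"
      by (auto simp: fun_eq_iff when_def algebra_simps)
    show "Poly_Mapping.lookup p a * (\<Sum>b. Poly_Mapping.lookup q b when c = a + b) = Poly_Mapping.lookup p a * Poly_Mapping.lookup q (c - a)"
      unfolding eq by simp
  qed
  also have "\<dots> = (\<Sum>a\<in>Poly_Mapping.keys p. Poly_Mapping.lookup p a * Poly_Mapping.lookup q (c - a))"
    by (rule Sum_any.expand_superset) (auto simp: in_keys_iff)
  finally show ?thesis .
qed

lemma graded_reps_add: "p \<in> graded_reps \<Longrightarrow> q \<in> graded_reps \<Longrightarrow> p + q \<in> graded_reps"
  using keys_add[of p q] by (auto simp: graded_reps_def lookup_add P_ge_add)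

lemma graded_reps_uminus: "p \<in> graded_reps \<Longrightarrow> - p \<in> graded_reps"
  by (auto simp: graded_reps_def P_ge_minus in_keys_iff)

lemma graded_reps_0: "0 \<in> graded_reps" and graded_reps_1: "1 \<in> graded_reps"
  by (auto simp: graded_reps_def lookup_one when_def P_ge_def)

lemma graded_reps_mult:
  assumes "p \<in> graded_reps" "q \<in> graded_reps"
  shows "p * q \<in> graded_reps"
proof -
  have "Poly_Mapping.keys (p * q) \<subseteq> value_group v"
  proof
    fix c assume "c \<in> Poly_Mapping.keys (p * q)"
    then obtain a b where "a \<in> Poly_Mapping.keys p" "b \<in> Poly_Mapping.keys q" "c = a + b"
      using keys_mult[of p q] by blast
    then show "c \<in> value_group v"
      using assms by (auto simp: graded_reps_def intro: value_group_add)
  qed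
  moreover have "Poly_Mapping.lookup (p * q) c \<in> P_ge v c" for c
  proof -
    have "Poly_Mapping.lookup p a * Poly_Mapping.lookup q (c - a) \<in> P_ge v c" for a
      using P_ge_mult[of "Poly_Mapping.lookup p a" a "Poly_Mapping.lookup q (c - a)" "c - a"] assms
      by (simp add: graded_reps_def)
    then show ?thesis
      unfolding lookup_mult_keys by (rule sum_in_P_ge)
  qed
  ultimately show ?thesis by (simp add: graded_reps_def)
qed

lemma graded_proj_carrier:
  assumes "p \<in> graded_reps"
  shows "graded_proj p \<in> carrier (graded_algebra v)"
proof -
  have "{a \<in> value_group v. graded_proj p a \<noteq> P_gt v a} \<subseteq> Poly_Mapping.keys p"
    by (auto simp: graded_proj_def in_keys_iff coset_zero)
  then have "finite {a \<in> value_group v. graded_proj p a \<noteq> P_gt v a}"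
    by (rule finite_subset) simp
  with assms show ?thesis
    by (auto simp: graded_algebra_def graded_proj_def graded_reps_def)
qed

lemma graded_proj_surj:
  assumes F: "F \<in> carrier (graded_algebra v)"
  obtains p where "p \<in> graded_reps" "F = graded_proj p"
proof -
  let ?S = "{a \<in> value_group v. F a \<noteq> P_gt v a}"
  have S: "finite ?S" and Fe: "F \<in> extensional (value_group v)"
    and Fc: "\<And>a. a \<in> value_group v \<Longrightarrow> \<exists>g\<in>P_ge v a. F a = g +o P_gt v a"
    using F by (auto simp: graded_algebra_def PiE_def)
  from Fc obtain r where r: "\<And>a. a \<in> value_group v \<Longrightarrow> r a \<in> P_ge v a \<and> F a = r a +o P_gt v a"
    by metis
  define r' where "r' = (\<lambda>a. if a \<in> ?S then r a else 0)"
  define p where "p = Abs_poly_mapping r'"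
  have supp: "{a. r' a \<noteq> 0} \<subseteq> ?S"
  proof
    fix a assume "a \<in> {a. r' a \<noteq> 0}"
    then have "r' a \<noteq> 0" by simp
    then show "a \<in> ?S" unfolding r'_def by metis
  qed
  then have "finite {a. r' a \<noteq> 0}" using S by (rule finite_subset)
  then have l: "Poly_Mapping.lookup p = r'" by (simp add: p_def)
  have "Poly_Mapping.keys p \<subseteq> value_group v"
    using supp by (auto simp: in_keys_iff l)
  then have "p \<in> graded_reps"
    using r by (simp add: graded_reps_def l r'_def)
  moreover have "F = graded_proj p"
  proof
    fix a show "F a = graded_proj p a"
      using r[of a] Fe by (auto simp: graded_proj_def l r'_def coset_zero extensional_def)
  qed
  ultimately show ?thesis by (rule that)
qed

lemma graded_proj_add:
  "graded_proj p \<oplus>\<^bsub>graded_algebra v\<^esub> graded_proj q = graded_proj (p + q)"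
  by (auto simp: graded_algebra_def graded_proj_def lookup_add coset_add intro!: restrict_ext)

lemma graded_proj_mult:
  assumes p: "p \<in> graded_reps" and q: "q \<in> graded_reps"
  shows "graded_proj p \<otimes>\<^bsub>graded_algebra v\<^esub> graded_proj q = graded_proj (p * q)"
proof -
  let ?S = "{a \<in> value_group v. graded_proj p a \<noteq> P_gt v a}"
  have S: "?S \<subseteq> Poly_Mapping.keys p"
    by (auto simp: graded_proj_def in_keys_iff coset_zero)
  then have fin: "finite ?S" by (rule finite_subset) simp
  have P: "Poly_Mapping.lookup p a \<in> P_ge v a" "Poly_Mapping.lookup q a \<in> P_ge v a" for a
    using p q by (auto simp: graded_reps_def)
  have "(\<Sum>a\<in>?S. graded_proj p a * graded_proj q (c - a)) + P_gt v c = Poly_Mapping.lookup (p * q) c +o P_gt v c"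
    if c: "c \<in> value_group v" for c
  proof -
    have "(\<Sum>a\<in>?S. graded_proj p a * graded_proj q (c - a)) + P_gt v c =
        (\<Sum>a\<in>?S. Poly_Mapping.lookup p a * Poly_Mapping.lookup q (c - a)) +o P_gt v c"
    proof (rule coset_sum[OF fin])
      fix a assume a: "a \<in> ?S"
      then have e: "graded_proj p a = Poly_Mapping.lookup p a +o P_gt v a"
        "graded_proj q (c - a) = Poly_Mapping.lookup q (c - a) +o P_gt v (c - a)"
        using c by (simp_all add: graded_proj_def value_group_diff)
      show "Poly_Mapping.lookup p a * Poly_Mapping.lookup q (c - a) \<in> graded_proj p a * graded_proj q (c - a)"
        unfolding e by (rule set_times_intro) (simp_all add: mem_coset_iff)
      show "graded_proj p a * graded_proj q (c - a) \<subseteq>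
          Poly_Mapping.lookup p a * Poly_Mapping.lookup q (c - a) +o P_gt v c"
        unfolding e using coset_mult_subset[OF P(1)[of a] P(2)[of "c - a"]] by simp
    qed
    also have "\<dots> = Poly_Mapping.lookup (p * q) c +o P_gt v c"
    proof -
      have "Poly_Mapping.lookup p a * Poly_Mapping.lookup q (c - a) \<in> P_gt v c" if "a \<in> Poly_Mapping.keys p - ?S" for a
      proof -
        have "Poly_Mapping.lookup p a \<in> P_gt v a"
          using that p by (auto simp: graded_proj_def graded_reps_def coset_eq_zero_iff)
        from P_gt_mult_left[OF this P(2)[of "c - a"]] show ?thesis by simp
      qed
      then have "(\<Sum>a\<in>Poly_Mapping.keys p - ?S. Poly_Mapping.lookup p a * Poly_Mapping.lookup q (c - a)) \<in> P_gt v c"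
        by (rule sum_in_P_gt)
      moreover have "Poly_Mapping.lookup (p * q) c = (\<Sum>a\<in>Poly_Mapping.keys p - ?S. Poly_Mapping.lookup p a * Poly_Mapping.lookup q (c - a)) +
          (\<Sum>a\<in>?S. Poly_Mapping.lookup p a * Poly_Mapping.lookup q (c - a))"
        unfolding lookup_mult_keys by (rule sum.subset_diff[OF S]) simp
      ultimately have "Poly_Mapping.lookup (p * q) c - (\<Sum>a\<in>?S. Poly_Mapping.lookup p a * Poly_Mapping.lookup q (c - a)) \<in> P_gt v c"
        by simp
      then show ?thesis by (simp add: coset_eq_iff[symmetric])
    qed
    finally show ?thesis .
  qed
  then show ?thesis
    by (auto simp: graded_algebra_def graded_proj_def[of "p * q"] intro!: restrict_ext)
qed

lemma graded_proj_0: "\<zero>\<^bsub>graded_algebra v\<^esub> = graded_proj 0"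
  by (simp add: graded_algebra_def graded_proj_def coset_zero)

lemma graded_proj_1: "\<one>\<^bsub>graded_algebra v\<^esub> = graded_proj 1"
  by (auto simp: graded_algebra_def graded_proj_def initial_form_def lookup_one when_def coset_zero
      intro!: restrict_ext)

lemma initial_form_carrier: "initial_form v g \<in> carrier (graded_algebra v)"
proof (cases "v g")
  case (Fin a)
  have "initial_form v g = graded_proj (Poly_Mapping.single a g)"
    using Fin by (auto simp: initial_form_def graded_proj_def lookup_single when_def coset_zero
        intro!: restrict_ext)
  moreover have "Poly_Mapping.single a g \<in> graded_reps"
    using Fin by (auto simp: graded_reps_def lookup_single when_def P_ge_def value_group_base)
  ultimately show ?thesis by (simp add: graded_proj_carrier)
next
  case Pinf
  then have "initial_form v g = graded_proj 0"
    by (simp add: initial_form_def graded_proj_def coset_zero)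
  then show ?thesis by (simp add: graded_proj_carrier graded_reps_0)
qed simp

theorem graded_algebra_cring: "cring (graded_algebra v)"
proof (rule cringI)
  note hom = graded_proj_add graded_proj_mult graded_proj_0 graded_proj_1 graded_proj_carrier
    graded_reps_add graded_reps_mult graded_reps_0 graded_reps_1 graded_reps_uminus
  show "abelian_group (graded_algebra v)"
  proof (rule abelian_groupI)
    fix F G H
    assume F: "F \<in> carrier (graded_algebra v)"
    obtain p where p: "p \<in> graded_reps" "F = graded_proj p" using graded_proj_surj[OF F] .
    show "\<zero>\<^bsub>graded_algebra v\<^esub> \<oplus>\<^bsub>graded_algebra v\<^esub> F = F"
      by (simp add: p hom)
    show "\<exists>G\<in>carrier (graded_algebra v). G \<oplus>\<^bsub>graded_algebra v\<^esub> F = \<zero>\<^bsub>graded_algebra v\<^esub>"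
      by (rule bexI[of _ "graded_proj (- p)"]) (simp_all add: p hom)
    assume G: "G \<in> carrier (graded_algebra v)"
    obtain q where q: "q \<in> graded_reps" "G = graded_proj q" using graded_proj_surj[OF G] .
    show "F \<oplus>\<^bsub>graded_algebra v\<^esub> G \<in> carrier (graded_algebra v)"
      "F \<oplus>\<^bsub>graded_algebra v\<^esub> G = G \<oplus>\<^bsub>graded_algebra v\<^esub> F"
      by (simp_all add: p q hom add.commute)
    assume H: "H \<in> carrier (graded_algebra v)"
    obtain r where r: "r \<in> graded_reps" "H = graded_proj r" using graded_proj_surj[OF H] .
    show "F \<oplus>\<^bsub>graded_algebra v\<^esub> G \<oplus>\<^bsub>graded_algebra v\<^esub> H =
        F \<oplus>\<^bsub>graded_algebra v\<^esub> (G \<oplus>\<^bsub>graded_algebra v\<^esub> H)"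
      by (simp add: p q r hom add.assoc)
  qed (simp add: hom)
  show "comm_monoid (graded_algebra v)"
  proof (rule comm_monoidI)
    fix F G H
    assume F: "F \<in> carrier (graded_algebra v)"
    obtain p where p: "p \<in> graded_reps" "F = graded_proj p" using graded_proj_surj[OF F] .
    show "\<one>\<^bsub>graded_algebra v\<^esub> \<otimes>\<^bsub>graded_algebra v\<^esub> F = F"
      by (simp add: p hom)
    assume G: "G \<in> carrier (graded_algebra v)"
    obtain q where q: "q \<in> graded_reps" "G = graded_proj q" using graded_proj_surj[OF G] .
    show "F \<otimes>\<^bsub>graded_algebra v\<^esub> G \<in> carrier (graded_algebra v)"
      "F \<otimes>\<^bsub>graded_algebra v\<^esub> G = G \<otimes>\<^bsub>graded_algebra v\<^esub> F"
      by (simp_all add: p q hom mult.commute)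
    assume H: "H \<in> carrier (graded_algebra v)"
    obtain r where r: "r \<in> graded_reps" "H = graded_proj r" using graded_proj_surj[OF H] .
    show "F \<otimes>\<^bsub>graded_algebra v\<^esub> G \<otimes>\<^bsub>graded_algebra v\<^esub> H =
        F \<otimes>\<^bsub>graded_algebra v\<^esub> (G \<otimes>\<^bsub>graded_algebra v\<^esub> H)"
      by (simp add: p q r hom mult.assoc)
  qed (simp add: hom)
  fix F G H
  assume F: "F \<in> carrier (graded_algebra v)" and G: "G \<in> carrier (graded_algebra v)"
    and H: "H \<in> carrier (graded_algebra v)"
  obtain p where p: "p \<in> graded_reps" "F = graded_proj p" using graded_proj_surj[OF F] .
  obtain q where q: "q \<in> graded_reps" "G = graded_proj q" using graded_proj_surj[OF G] .
  obtain r where r: "r \<in> graded_reps" "H = graded_proj r" using graded_proj_surj[OF H] .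
  show "(F \<oplus>\<^bsub>graded_algebra v\<^esub> G) \<otimes>\<^bsub>graded_algebra v\<^esub> H =
      F \<otimes>\<^bsub>graded_algebra v\<^esub> H \<oplus>\<^bsub>graded_algebra v\<^esub> G \<otimes>\<^bsub>graded_algebra v\<^esub> H"
    by (simp add: p q r hom distrib_right)
qed

end

end

theory Submission
  imports Defs
begin

text \<open>
  The abstract key polynomials are governed by slopes, the MacLane--Vaquie ones by the graded algebra.
  The two are brought together by writing a bound on slopes as an equality of valuations. For a slope
  \<open>e\<close> let \<open>W\<close> be the valuation \<open>f \<mapsto> min\<^sub>b (\<nu> (\<partial>\<^sub>b f) + b e)\<close>, which is the Gauss valuation of \<open>f(x + y)\<close> with
  value \<open>e\<close> at \<open>y\<close>. Then \<open>W \<le> \<nu>\<close>, and \<open>\<epsilon>(f) \<le> e\<close> holds if and only if \<open>W f = \<nu> f\<close>. In that case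
  \<open>\<epsilon>(f) = e\<close> if and only if the largest index \<open>b\<close> attaining the minimum is positive, and these indices
  add up in products (\<open>taylor_val_index_mult\<close>).

  Since the initial form of \<open>\<phi>\<close> for \<open>\<mu>\<close> is prime and divides nothing of smaller degree, \<open>\<phi>\<close> is irreducible,
  and each non-zero \<open>a\<close> of smaller degree has a Bezout relation \<open>b a + c \<phi> = 1\<close>. The indices of the two summands
  decide which of them carries the value of \<open>1\<close>.

  Let \<open>\<phi>\<close> be a key polynomial for \<open>\<nu>\<close>. Then \<open>c \<phi>\<close> has positive value (\<open>key_polynomial_bezout_pos\<close>), so
  \<open>\<nu> (b a) = 0\<close>. Were \<open>\<mu> (b a)\<close> negative, \<open>\<phi>\<close> would divide \<open>b a\<close> for \<open>\<mu>\<close>, hence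
  one of the factors, of smaller degree; so \<open>\<mu> (b a) = 0\<close>, and \<open>\<mu>\<close> and \<open>\<nu>\<close> agree
  at \<open>a\<close>. If \<open>\<phi>\<close> does not belong to \<open>\<Phi>\<close>, they agree at \<open>\<phi>\<close> too, and the same relation shows that the
  initial form of \<open>a\<close> for \<open>\<mu>\<close> is a unit. Hence no MacLane--Vaquie key polynomial has smaller degree than \<open>\<phi>\<close>.

  Conversely, in both cases \<open>\<mu>\<close> and \<open>\<nu>\<close> agree below the degree of \<open>\<phi>\<close>: by minimality of the degree in \<open>\<Phi>\<close>,
  respectively because all non-zero polynomials below \<open>deg(\<mu>)\<close> have units as initial forms
  (\<open>val_unit_below_KP_degree\<close>), and \<open>\<mu> \<le> \<nu>\<close> must be an equality at units. In the second case
  they agree at \<open>\<phi>\<close> as well, since \<open>\<phi>\<close> does not belong to \<open>\<Phi>\<close>. This yields the truncation, as \<open>\<mu>\<close> is its own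
  truncation at \<open>\<phi>\<close> (\<open>truncation_KP\<close>).

  It remains to compare slopes: those of \<open>\<nu>\<close> in the first case, and in the second those of \<open>\<mu>\<close>, which are the
  same up to \<open>\<phi>\<close>. The slope of \<open>\<phi>\<close> is infinite if \<open>\<nu> \<phi>\<close> is, so let it be finite. If some \<open>q\<close> of smaller degree had \<open>\<epsilon>(q) \<ge> \<epsilon>(\<phi>)\<close>, take \<open>W\<close> for \<open>e = \<epsilon>(q)\<close>. Either \<open>W\<close> differs from the
  valuation in smaller degree, and then the initial form of \<open>\<phi>\<close> is that of a polynomial of smaller degree, which
  is impossible; or \<open>W\<close> agrees with it, and then an inverse of \<open>q\<close> up to terms of positive value contradicts
  the positive index of \<open>q\<close> (\<open>key_polynomial_criterion\<close>).
\<close>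

section \<open>Values in the extended group\<close>

lemma nsmul_Fin [simp]: "nsmul k (Fin a) = Fin (nsmul k a)"
  by (induction k) (simp_all add: zero_extended_def)

lemma nsmul_Pinf [simp]: "k \<noteq> 0 \<Longrightarrow> nsmul k (\<infinity>) = (\<infinity> :: 'g::linordered_ab_group_add extended)"
proof (induction k)
  case (Suc k)
  then show ?case by (cases "k = 0") (simp_all add: zero_extended_def)
qed simp

lemma nsmul_mono: "x \<le> y \<Longrightarrow> nsmul k x \<le> nsmul k (y :: 'g::linordered_ab_group_add extended)"
  by (induction k) (simp_all add: add_mono)

lemma nsmul_extended_le_iff:
  fixes x y :: "'g::linordered_ab_group_add extended"
  assumes "k \<noteq> 0" "x \<noteq> -\<infinity>" "y \<noteq> -\<infinity>"
  shows "nsmul k x \<le> nsmul k y \<longleftrightarrow> x \<le> y"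
  using assms by (cases x; cases y) (simp_all add: nsmul_le_iff)

lemma nsmul_extended_less_iff:
  fixes x y :: "'g::linordered_ab_group_add extended"
  assumes "k \<noteq> 0" "x \<noteq> -\<infinity>" "y \<noteq> -\<infinity>"
  shows "nsmul k x < nsmul k y \<longleftrightarrow> x < y"
  using nsmul_extended_le_iff[OF assms(1,3,2)] by (simp add: not_le[symmetric])

lemma extended_less_add:
  fixes x y z :: "'g::linordered_ab_group_add extended"
  shows "x < y \<Longrightarrow> x + z = Fin c \<Longrightarrow> Fin c < y + z"
  by (cases x; cases y; cases z) auto

section \<open>Values of sums\<close>

context
  fixes v :: "'k::field poly \<Rightarrow> 'g::linordered_ab_group_add extended"
  assumes v: "is_valuation v"
begin

lemma val_diff: "min (v f) (v g) \<le> v (f - g)"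
  using val_add[OF v, of f "- g"] by (simp add: val_uminus[OF v])

lemma val_diff_commute: "v (f - g) = v (g - f)"
  using val_uminus[OF v, of "f - g"] by simp

lemma val_add_eq_left:
  assumes "v f < v g" shows "v (f + g) = v f"
  using val_add[OF v, of f g] val_diff[of "f + g" g] assms by (auto simp: min_def split: if_splits)

lemma val_diff_eq_left:
  assumes "v f < v g" shows "v (f - g) = v f"
  using val_add_eq_left[of f "- g"] assms by (simp add: val_uminus[OF v])

lemma val_eq_of_diff:
  assumes "v f < v (f - g)" shows "v g = v f"
  using val_diff_eq_left[of f "f - g"] assms by simp

lemma val_power: "v (f ^ n) = nsmul n (v f)"
  by (induction n) (simp_all add: val_1[OF v] val_mult[OF v] zero_extended_def add.commute)

lemma val_sum_greater:
  assumes "finite A" "\<And>i. i \<in> A \<Longrightarrow> Fin c < v (f i)" shows "Fin c < v (sum f A)"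
  using sum_in_P_gt[OF v, of A f c] assms by (simp add: P_gt_def)

lemma val_sum_ge:
  assumes "finite A" "\<And>i. i \<in> A \<Longrightarrow> c \<le> v (f i)" shows "c \<le> v (sum f A)"
  using assms
proof (induction A)
  case (insert i A)
  then have "c \<le> min (v (f i)) (v (sum f A))" by simp
  also have "\<dots> \<le> v (f i + sum f A)" by (rule val_add[OF v])
  finally show ?case using insert by simp
qed (simp add: val_0[OF v])

lemma val_inverse_lead_coeff_finite:
  assumes "f \<noteq> 0"
  obtains a where "v [:inverse (lead_coeff f):] = Fin a"
proof -
  have "v [:inverse (lead_coeff f):] \<noteq> \<infinity>"
    unfolding val_const[OF v] using assms by simp
  then show thesis
    using val_not_Minf[OF v] that by (cases "v [:inverse (lead_coeff f):]") auto
qed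

text \<open>The multiples of a valuation by positive integers serve to clear the denominators of slopes.\<close>

lemma is_valuation_nsmul:
  assumes "k \<noteq> 0" shows "is_valuation (\<lambda>f. nsmul k (v f))"
  unfolding is_valuation_def
proof (intro conjI allI)
  fix f g and c :: 'k
  show "nsmul k (v f) \<noteq> -\<infinity>"
    using val_not_Minf[OF v, of f] assms by (cases "v f") simp_all
  show "nsmul k (v (f * g)) = nsmul k (v f) + nsmul k (v g)"
    by (simp add: val_mult[OF v] nsmul_add)
  show "min (nsmul k (v f)) (nsmul k (v g)) \<le> nsmul k (v (f + g))"
    using nsmul_mono[OF val_add[OF v, of f g], of k] by (auto simp: min_def split: if_splits)
  show "nsmul k (v [:c:]) = \<infinity> \<longleftrightarrow> c = 0"
    using val_const[OF v, of c] val_not_Minf[OF v, of "[:c:]"] assms by (cases "v [:c:]") simp_all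
qed

end

section \<open>Hasse derivatives are Taylor coefficients\<close>

lemma map_poly_const_mult:
  "map_poly (\<lambda>c. [:c:]) (f * g :: 'k::field poly) = map_poly (\<lambda>c. [:c:]) f * map_poly (\<lambda>c. [:c:]) g"
proof (rule poly_eqI)
  fix n
  have const_sum: "[:\<Sum>i\<in>A. h i:] = (\<Sum>i\<in>A. [:h i:])" for h :: "nat \<Rightarrow> 'k" and A
    by (rule poly_eqI) (simp add: coeff_sum coeff_pCons split: nat.split)
  show "coeff (map_poly (\<lambda>c. [:c:]) (f * g)) n = coeff (map_poly (\<lambda>c. [:c:]) f * map_poly (\<lambda>c. [:c:]) g) n"
    by (simp add: coeff_map_poly coeff_mult const_sum mult.commute)
qed

lemma map_poly_const_add:
  "map_poly (\<lambda>c. [:c:]) (f + g :: 'k::field poly) = map_poly (\<lambda>c. [:c:]) f + map_poly (\<lambda>c. [:c:]) g"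
  by (rule poly_eqI) (simp add: coeff_map_poly)

lemma hasse_add: "hasse b (f + g) = hasse b f + hasse b g"
  by (simp add: hasse_def map_poly_const_add pcompose_add)

lemma hasse_mult: "hasse b (f * g) = (\<Sum>i\<le>b. hasse i f * hasse (b - i) g)"
  by (simp add: hasse_def map_poly_const_mult pcompose_mult coeff_mult)

lemma hasse_0 [simp]: "hasse 0 f = f"
proof -
  have "hasse 0 f = poly (map_poly (\<lambda>c. [:c:]) f) [:0, 1:]"
    by (simp add: hasse_def poly_0_coeff_0[symmetric] poly_pcompose)
  also have "\<dots> = f"
    by (induction f) (auto simp: map_poly_pCons)
  finally show ?thesis .
qed

lemma hasse_zero [simp]: "hasse b 0 = 0"
  by (simp add: hasse_def)

lemma hasse_const: "b \<noteq> 0 \<Longrightarrow> degree f = 0 \<Longrightarrow> hasse b f = 0"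
  by (rule hasse_eq_0) simp

lemma degree_hasse: "degree (hasse b f) \<le> degree f - b"
proof (induction f arbitrary: b)
  case (pCons a p)
  show ?case
  proof (cases "b = 0 \<or> p = 0")
    case True
    then show ?thesis by (cases "b = 0") (auto simp: hasse_const)
  next
    case False
    then have b: "b \<noteq> 0" and p: "p \<noteq> 0" by auto
    have "map_poly (\<lambda>c. [:c:]) (pCons a p) = pCons [:a:] (map_poly (\<lambda>c. [:c:]) p)"
      by (simp add: map_poly_pCons)
    then have e: "hasse b (pCons a p) = [:0, 1:] * hasse b p + hasse (b - 1) p"
      using b by (cases b) (simp_all add: hasse_def pcompose_pCons)
    have "degree ([:0, 1:] * hasse b p) \<le> Suc (degree p) - b"
    proof (cases "degree p < b")
      case False
      have "degree ([:0, 1:] * hasse b p) \<le> Suc (degree (hasse b p))"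
        using degree_mult_le[of "[:0, 1:]" "hasse b p"] by simp
      with pCons.IH[of b] False show ?thesis by linarith
    qed (simp add: hasse_eq_0)
    moreover have "degree (hasse (b - 1) p) \<le> Suc (degree p) - b"
      using pCons.IH[of "b - 1"] b by simp
    ultimately show ?thesis using p by (simp add: e degree_add_le)
  qed
qed simp

section \<open>The valuation of Taylor expansions\<close>

text \<open>
  Put the value \<open>x\<close> on an indeterminate \<open>y\<close> and extend \<open>v\<close> to \<open>K[x][y]\<close> as a Gauss valuation;
  \<open>taylor_val v x f\<close> is the value of \<open>f(x + y)\<close>. It is a valuation on \<open>K[x]\<close>, at most \<open>v\<close>, and it agrees with
  \<open>v\<close> at \<open>f\<close> exactly if no quotient \<open>(v f - v (hasse b f)) / b\<close> exceeds \<open>x\<close>. Thus a bound on \<open>epsilon\<close>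
  becomes an equality between two valuations.
\<close>

definition taylor_val ::
    "('k::field poly \<Rightarrow> 'g::linordered_ab_group_add extended) \<Rightarrow> 'g \<Rightarrow> 'k poly \<Rightarrow> 'g extended"
  where "taylor_val v x f = Min ((\<lambda>b. v (hasse b f) + Fin (nsmul b x)) ` {..degree f})"

text \<open>
  The largest index attaining the minimum, rather than an arbitrary one, is what adds up in products.
\<close>

definition taylor_index ::
    "('k::field poly \<Rightarrow> 'g::linordered_ab_group_add extended) \<Rightarrow> 'g \<Rightarrow> 'k poly \<Rightarrow> nat"
  where "taylor_index v x f =
    Max {b. b \<le> degree f \<and> v (hasse b f) + Fin (nsmul b x) = taylor_val v x f}"

context
  fixes v :: "'k::field poly \<Rightarrow> 'g::linordered_ab_group_add extended" and x :: 'g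
  assumes v: "is_valuation v"
begin

lemma taylor_val_le: "taylor_val v x f \<le> v (hasse b f) + Fin (nsmul b x)"
proof (cases "b \<le> degree f")
  case True
  then show ?thesis unfolding taylor_val_def by (intro Min_le) auto
next
  case False
  then show ?thesis by (simp add: hasse_eq_0 val_0[OF v])
qed

lemma taylor_val_le_val: "taylor_val v x f \<le> v f"
  using taylor_val_le[of f 0] by (cases "v f") simp_all

lemma taylor_index_attained:
  "taylor_index v x f \<le> degree f"
  "v (hasse (taylor_index v x f) f) + Fin (nsmul (taylor_index v x f) x) = taylor_val v x f"
proof -
  let ?I = "{b. b \<le> degree f \<and> v (hasse b f) + Fin (nsmul b x) = taylor_val v x f}"
  have "taylor_val v x f \<in> (\<lambda>b. v (hasse b f) + Fin (nsmul b x)) ` {..degree f}"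
    unfolding taylor_val_def by (intro Min_in) auto
  then have "?I \<noteq> {}" by auto
  then have "taylor_index v x f \<in> ?I"
    unfolding taylor_index_def by (intro Max_in) auto
  then show "taylor_index v x f \<le> degree f"
    "v (hasse (taylor_index v x f) f) + Fin (nsmul (taylor_index v x f) x) = taylor_val v x f" by auto
qed

lemma taylor_index_ge:
  assumes "b \<le> degree f" "v (hasse b f) + Fin (nsmul b x) = taylor_val v x f"
  shows "b \<le> taylor_index v x f"
  unfolding taylor_index_def using assms by (intro Max_ge) auto

lemma taylor_val_not_Minf: "taylor_val v x f \<noteq> -\<infinity>"
  using taylor_index_attained(2)[of f] val_not_Minf[OF v, of "hasse (taylor_index v x f) f"]
  by (cases "v (hasse (taylor_index v x f) f)") auto

lemma taylor_val_finite:
  assumes "f \<noteq> 0" obtains a where "taylor_val v x f = Fin a"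
proof -
  have "v (hasse (degree f) f) \<noteq> \<infinity>"
    using assms by (simp add: hasse_degree val_const[OF v])
  then have "taylor_val v x f \<noteq> \<infinity>"
    using taylor_val_le[of f "degree f"] val_not_Minf[OF v, of "hasse (degree f) f"]
    by (cases "v (hasse (degree f) f)") auto
  with taylor_val_not_Minf show thesis using that by (cases "taylor_val v x f") auto
qed

lemma taylor_val_zero: "taylor_val v x 0 = \<infinity>"
  by (simp add: taylor_val_def val_0[OF v])

lemma taylor_index_less:
  assumes "f \<noteq> 0" "taylor_index v x f < b"
  shows "taylor_val v x f < v (hasse b f) + Fin (nsmul b x)"
proof (cases "b \<le> degree f")
  case True
  then show ?thesis
    using taylor_index_ge[OF True] taylor_val_le[of f b] assms(2) by (auto simp: order.order_iff_strict)
next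
  case False
  obtain a where "taylor_val v x f = Fin a" using taylor_val_finite[OF assms(1)] .
  with False show ?thesis by (simp add: hasse_eq_0 val_0[OF v])
qed

lemma taylor_in_P_ge:
  assumes "taylor_val v x f = Fin a" shows "hasse b f \<in> P_ge v (a - nsmul b x)"
  using taylor_val_le[of f b] assms
  by (cases "v (hasse b f)") (auto simp: P_ge_def algebra_simps)

lemma taylor_in_P_gt:
  assumes "taylor_val v x f = Fin a" "taylor_index v x f < b"
  shows "hasse b f \<in> P_gt v (a - nsmul b x)"
proof -
  have "f \<noteq> 0" using assms(1) taylor_val_zero by auto
  from taylor_index_less[OF this assms(2)] show ?thesis
    using assms(1) by (cases "v (hasse b f)") (auto simp: P_gt_def algebra_simps)
qed

text \<open>
  The value and the index of a product are computed from upper and lower estimates of its Hasse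
  derivatives, for which this is the criterion.
\<close>

lemma taylor_val_index_eqI:
  assumes ge: "\<And>b. hasse b h \<in> P_ge v (c - nsmul b x)"
    and eq: "v (hasse l h) = Fin (c - nsmul l x)"
    and gt: "\<And>b. l < b \<Longrightarrow> hasse b h \<in> P_gt v (c - nsmul b x)"
  shows "taylor_val v x h = Fin c" "taylor_index v x h = l"
proof -
  have "Fin c \<le> v (hasse b h) + Fin (nsmul b x)" for b
    using ge[of b] by (cases "v (hasse b h)") (auto simp: P_ge_def algebra_simps)
  then have "Fin c \<le> taylor_val v x h" unfolding taylor_val_def by simp
  moreover have "taylor_val v x h \<le> Fin c"
    using taylor_val_le[of h l] eq by simp
  ultimately show tv: "taylor_val v x h = Fin c" by simp
  have "l \<le> degree h"
  proof (rule ccontr)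
    assume "\<not> l \<le> degree h"
    then have "hasse l h = 0" by (simp add: hasse_eq_0)
    with eq show False by (simp add: val_0[OF v])
  qed
  then have "l \<le> taylor_index v x h"
    using eq tv by (intro taylor_index_ge) simp_all
  moreover have "\<not> l < taylor_index v x h"
    using gt[of "taylor_index v x h"] taylor_index_attained(2)[of h] tv
    by (cases "v (hasse (taylor_index v x h) h)") (auto simp: P_gt_def algebra_simps)
  ultimately show "taylor_index v x h = l" by simp
qed

text \<open>
  This is Gauss's lemma for \<open>f(x + y)\<close> and \<open>g(x + y)\<close>. In the Leibniz formula for the derivative whose order is the
  sum of the two indices, only one summand has the least possible value, because every other summand
  has a factor of order beyond its index; hence nothing cancels.
\<close>

lemma taylor_val_index_mult:
  assumes f: "f \<noteq> 0" and g: "g \<noteq> 0"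
  shows taylor_val_mult_nz: "taylor_val v x (f * g) = taylor_val v x f + taylor_val v x g"
    and taylor_index_mult: "taylor_index v x (f * g) = taylor_index v x f + taylor_index v x g"
proof -
  obtain a where a: "taylor_val v x f = Fin a" using taylor_val_finite[OF f] .
  obtain c where c: "taylor_val v x g = Fin c" using taylor_val_finite[OF g] .
  let ?i = "taylor_index v x f" and ?j = "taylor_index v x g"
  have split: "(a - nsmul i x) + (c - nsmul (b - i) x) = a + c - nsmul b x" if "i \<le> b" for i b
    using nsmul_plus[of i "b - i" x] that by (simp add: algebra_simps)
  have ge: "hasse i f * hasse (b - i) g \<in> P_ge v (a + c - nsmul b x)" if "i \<le> b" for i b
    using P_ge_mult[OF v taylor_in_P_ge[OF a, of i] taylor_in_P_ge[OF c, of "b - i"]] split[OF that] by simp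
  have gt: "hasse i f * hasse (b - i) g \<in> P_gt v (a + c - nsmul b x)"
    if "i \<le> b" "?i < i \<or> ?j < b - i" for i b
    using that(2)
  proof
    assume "?i < i"
    from P_gt_mult_left[OF v taylor_in_P_gt[OF a this] taylor_in_P_ge[OF c, of "b - i"]]
    show ?thesis by (simp only: split[OF that(1)])
  next
    assume "?j < b - i"
    from P_gt_mult_right[OF v taylor_in_P_ge[OF a, of i] taylor_in_P_gt[OF c this]]
    show ?thesis by (simp only: split[OF that(1)])
  qed
  have main: "v (hasse (?i + ?j) (f * g)) = Fin (a + c - nsmul (?i + ?j) x)"
  proof -
    let ?t = "\<lambda>i. hasse i f * hasse (?i + ?j - i) g"
    have "v (hasse ?i f) = Fin (a - nsmul ?i x)" "v (hasse ?j g) = Fin (c - nsmul ?j x)"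
      using taylor_index_attained(2)[of f] taylor_index_attained(2)[of g] a c
      by (cases "v (hasse ?i f)"; cases "v (hasse ?j g)"; auto simp: algebra_simps)+
    then have t: "v (?t ?i) = Fin (a + c - nsmul (?i + ?j) x)"
      using split[of ?i "?i + ?j"] by (simp add: val_mult[OF v])
    have "sum ?t ({..?i + ?j} - {?i}) \<in> P_gt v (a + c - nsmul (?i + ?j) x)"
      by (rule sum_in_P_gt[OF v], rule gt) auto
    then have "v (?t ?i) < v (sum ?t ({..?i + ?j} - {?i}))"
      using t by (simp add: P_gt_def)
    then have "v (?t ?i + sum ?t ({..?i + ?j} - {?i})) = v (?t ?i)"
      by (rule val_add_eq_left[OF v])
    moreover have "v (hasse (?i + ?j) (f * g)) = v (?t ?i + sum ?t ({..?i + ?j} - {?i}))"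
      unfolding hasse_mult by (rule arg_cong[of _ _ v], rule sum.remove) auto
    ultimately show ?thesis by (simp only: t)
  qed
  have ge': "hasse b (f * g) \<in> P_ge v (a + c - nsmul b x)" for b
    unfolding hasse_mult by (rule sum_in_P_ge[OF v]) (use ge in simp)
  have gt': "hasse b (f * g) \<in> P_gt v (a + c - nsmul b x)" if "?i + ?j < b" for b
    unfolding hasse_mult by (rule sum_in_P_gt[OF v], rule gt) (use that in auto)
  note taylor_val_index_eqI[OF ge' main gt']
  then show "taylor_val v x (f * g) = taylor_val v x f + taylor_val v x g"
    "taylor_index v x (f * g) = ?i + ?j" by (simp_all add: a c)
qed

lemma taylor_val_const: "degree f = 0 \<Longrightarrow> taylor_val v x f = v f"
  by (cases "v f") (simp_all add: taylor_val_def)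

lemma is_valuation_taylor_val: "is_valuation (taylor_val v x)"
  unfolding is_valuation_def
proof (intro conjI allI)
  fix f g and c :: 'k
  show "taylor_val v x f \<noteq> -\<infinity>" by (rule taylor_val_not_Minf)
  show "taylor_val v x (f * g) = taylor_val v x f + taylor_val v x g"
  proof (cases "f = 0 \<or> g = 0")
    case True
    then show ?thesis
      using taylor_val_not_Minf[of f] taylor_val_not_Minf[of g]
      by (cases "taylor_val v x f"; cases "taylor_val v x g") (auto simp: taylor_val_zero)
  qed (simp add: taylor_val_mult_nz)
  show "min (taylor_val v x f) (taylor_val v x g) \<le> taylor_val v x (f + g)"
  proof -
    let ?b = "taylor_index v x (f + g)"
    have "min (taylor_val v x f) (taylor_val v x g)
        \<le> min (v (hasse ?b f) + Fin (nsmul ?b x)) (v (hasse ?b g) + Fin (nsmul ?b x))"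
      by (intro min.mono taylor_val_le)
    also have "\<dots> \<le> v (hasse ?b (f + g)) + Fin (nsmul ?b x)"
      using val_add[OF v, of "hasse ?b f" "hasse ?b g"]
      by (auto simp: hasse_add min_def add_right_mono split: if_splits intro: add_right_mono order.trans)
    finally show ?thesis by (simp add: taylor_index_attained(2))
  qed
  show "taylor_val v x [:c:] = \<infinity> \<longleftrightarrow> c = 0"
    by (simp add: taylor_val_const val_const[OF v])
qed

text \<open>
  The derivatives of \<open>f\<close> and \<open>g\<close> of positive order are opposite. At the index of \<open>g\<close> this transports the
  value of \<open>g\<close> to \<open>f\<close>. Applied to a Bezout relation, this compares the two summands.
\<close>

lemma taylor_val_le_of_sum_eq_1:
  assumes sum: "f + g = 1" and g: "g \<noteq> 0" "taylor_index v x g \<noteq> 0"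
  shows "taylor_val v x f \<le> taylor_val v x g"
    and "f \<noteq> 0 \<Longrightarrow> taylor_index v x f < taylor_index v x g \<Longrightarrow> taylor_val v x f < taylor_val v x g"
proof -
  let ?b = "taylor_index v x g"
  have "hasse ?b f + hasse ?b g = 0"
    using arg_cong[OF sum, of "hasse ?b"] g(2) by (simp add: hasse_add hasse_const)
  then have "v (hasse ?b f) = v (hasse ?b g)"
    using val_uminus[OF v] by (metis add_eq_0_iff)
  then have e: "v (hasse ?b f) + Fin (nsmul ?b x) = taylor_val v x g"
    using taylor_index_attained(2)[of g] by simp
  show "taylor_val v x f \<le> taylor_val v x g"
    using taylor_val_le[of f ?b] e by simp
  show "taylor_val v x f < taylor_val v x g" if "f \<noteq> 0" "taylor_index v x f < ?b"
    using taylor_index_less[OF that] e by simp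
qed

end

section \<open>Divisibility of initial forms\<close>

text \<open>
  The relation \<open>g |\<^sub>v f\<close> without the graded algebra: the initial form of \<open>f\<close> vanishes, or it is that of a
  multiple of \<open>g\<close>.
\<close>

definition val_dvd ::
    "('k::field poly \<Rightarrow> 'g::linordered_ab_group_add extended) \<Rightarrow> 'k poly \<Rightarrow> 'k poly \<Rightarrow> bool"
  where "val_dvd v g f \<longleftrightarrow> v f = \<infinity> \<or> (\<exists>q. v f < v (f - g * q))"

text \<open>
  The initial form of \<open>f\<close> is a unit of the graded algebra.
\<close>

definition val_unit ::
    "('k::field poly \<Rightarrow> 'g::linordered_ab_group_add extended) \<Rightarrow> 'k poly \<Rightarrow> bool"
  where "val_unit v f \<longleftrightarrow> (\<exists>g. Fin 0 < v (f * g - 1))"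

context
  fixes v :: "'k::field poly \<Rightarrow> 'g::linordered_ab_group_add extended"
  assumes v: "is_valuation v"
begin

lemma single_in_graded_reps: "v f = Fin a \<Longrightarrow> Poly_Mapping.single a f \<in> graded_reps v"
  by (auto simp: graded_reps_def[OF v] lookup_single when_def P_ge_def value_group_base[OF v] val_0[OF v])

lemma initial_form_eq_proj:
  assumes "v f = Fin a"
  shows "initial_form v f = graded_proj v (Poly_Mapping.single a f)"
  using assms
  by (auto simp: initial_form_def graded_proj_def[OF v] lookup_single when_def coset_zero[OF v]
      intro!: restrict_ext)

lemma initial_form_infinite:
  assumes "v f = \<infinity>" shows "initial_form v f = \<zero>\<^bsub>graded_algebra v\<^esub>"
  using assms by (simp add: initial_form_def graded_algebra_def)

lemma graded_proj_eq_iff: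
  "graded_proj v p = graded_proj v q \<longleftrightarrow>
    (\<forall>a\<in>value_group v. Poly_Mapping.lookup p a - Poly_Mapping.lookup q a \<in> P_gt v a)"
proof
  assume eq: "graded_proj v p = graded_proj v q"
  show "\<forall>a\<in>value_group v. Poly_Mapping.lookup p a - Poly_Mapping.lookup q a \<in> P_gt v a"
  proof
    fix a assume "a \<in> value_group v"
    then show "Poly_Mapping.lookup p a - Poly_Mapping.lookup q a \<in> P_gt v a"
      using fun_cong[OF eq, of a] by (simp add: graded_proj_def[OF v] coset_eq_iff[OF v])
  qed
next
  assume "\<forall>a\<in>value_group v. Poly_Mapping.lookup p a - Poly_Mapping.lookup q a \<in> P_gt v a"
  then show "graded_proj v p = graded_proj v q"
    unfolding graded_proj_def[OF v] by (intro restrict_ext) (simp add: coset_eq_iff[OF v])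
qed

lemma initial_form_mult:
  "initial_form v (f * g) = initial_form v f \<otimes>\<^bsub>graded_algebra v\<^esub> initial_form v g"
proof (cases "v f = \<infinity> \<or> v g = \<infinity>")
  case True
  interpret cring "graded_algebra v" by (rule graded_algebra_cring[OF v])
  have "v (f * g) = \<infinity>"
    using True val_not_Minf[OF v] val_mult[OF v, of f g] by (cases "v f"; cases "v g") auto
  with True show ?thesis
    by (auto simp: initial_form_infinite initial_form_carrier[OF v])
next
  case False
  then obtain a b where ab: "v f = Fin a" "v g = Fin b"
    using val_not_Minf[OF v] by (cases "v f"; cases "v g") auto
  then have "v (f * g) = Fin (a + b)" by (simp add: val_mult[OF v])
  with ab show ?thesis
    by (simp add: initial_form_eq_proj graded_proj_mult[OF v] single_in_graded_reps mult_single)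
qed

lemma lookup_single_mult:
  assumes "v g = Fin c"
  shows "Poly_Mapping.lookup (Poly_Mapping.single c g * h) a = g * Poly_Mapping.lookup h (a - c)"
proof -
  have "g \<noteq> 0" using assms by (auto simp: val_0[OF v])
  then show ?thesis by (simp add: lookup_mult_keys[OF v])
qed

text \<open>
  An ideal generated by a homogeneous element is graded, so membership is tested on components; for a
  component it is a congruence between polynomials.
\<close>

lemma graded_proj_in_ideal_iff:
  assumes g: "v g = Fin c" and p: "p \<in> graded_reps v"
  shows "graded_proj v p \<in> PIdl\<^bsub>graded_algebra v\<^esub> (initial_form v g) \<longleftrightarrow>
    (\<forall>a\<in>value_group v. \<exists>q. Poly_Mapping.lookup p a - g * q \<in> P_gt v a)"
proof
  interpret cring "graded_algebra v" by (rule graded_algebra_cring[OF v])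
  note G = single_in_graded_reps[OF g]
  have times: "initial_form v g \<otimes>\<^bsub>graded_algebra v\<^esub> graded_proj v h
      = graded_proj v (Poly_Mapping.single c g * h)" if "h \<in> graded_reps v" for h
    using that by (simp add: initial_form_eq_proj[OF g] graded_proj_mult[OF v G])
  {
    assume "graded_proj v p \<in> PIdl\<^bsub>graded_algebra v\<^esub> (initial_form v g)"
    then obtain y where y: "y \<in> carrier (graded_algebra v)"
      and e: "graded_proj v p = initial_form v g \<otimes>\<^bsub>graded_algebra v\<^esub> y"
      by (auto simp: cgenideal_def m_comm initial_form_carrier[OF v])
    obtain h where h: "h \<in> graded_reps v" "y = graded_proj v h"
      using graded_proj_surj[OF v y] .
    then have "graded_proj v p = graded_proj v (Poly_Mapping.single c g * h)"
      using e times by simp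
    then show "\<forall>a\<in>value_group v. \<exists>q. Poly_Mapping.lookup p a - g * q \<in> P_gt v a"
      unfolding graded_proj_eq_iff lookup_single_mult[OF g] by blast
  }
  assume "\<forall>a\<in>value_group v. \<exists>q. Poly_Mapping.lookup p a - g * q \<in> P_gt v a"
  then obtain q where q: "\<And>a. a \<in> value_group v \<Longrightarrow> Poly_Mapping.lookup p a - g * q a \<in> P_gt v a"
    by metis
  have c: "c \<in> value_group v" using g by (rule value_group_base[OF v])
  define h where "h = Abs_poly_mapping (\<lambda>b. if b + c \<in> Poly_Mapping.keys p then q (b + c) else 0)"
  have "{b. (if b + c \<in> Poly_Mapping.keys p then q (b + c) else 0) \<noteq> 0}
      \<subseteq> (\<lambda>a. a - c) ` Poly_Mapping.keys p"
    by (force split: if_splits intro: rev_image_eqI[of "_ + c"])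
  then have "finite {b. (if b + c \<in> Poly_Mapping.keys p then q (b + c) else 0) \<noteq> 0}"
    by (rule finite_subset) simp
  then have h: "Poly_Mapping.lookup h = (\<lambda>b. if b + c \<in> Poly_Mapping.keys p then q (b + c) else 0)"
    by (simp add: h_def)
  have keys: "Poly_Mapping.keys p \<subseteq> value_group v"
    using p by (simp add: graded_reps_def[OF v])
  have "q a \<in> P_ge v (a - c)" if "a \<in> value_group v" for a
  proof -
    have "Poly_Mapping.lookup p a - (Poly_Mapping.lookup p a - g * q a) \<in> P_ge v a"
      using P_ge_add[OF v _ P_ge_minus[OF v P_gt_imp_ge[OF v q[OF that]]], of "Poly_Mapping.lookup p a"] p
      by (simp add: graded_reps_def[OF v])
    then have "Fin a \<le> Fin c + v (q a)"
      using g by (simp add: P_ge_def val_mult[OF v])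
    then show ?thesis by (cases "v (q a)") (auto simp: P_ge_def algebra_simps)
  qed
  moreover have "Poly_Mapping.keys h \<subseteq> value_group v"
  proof
    fix b assume "b \<in> Poly_Mapping.keys h"
    then have "b + c \<in> value_group v"
      using keys by (auto simp: in_keys_iff h split: if_splits)
    then show "b \<in> value_group v" using value_group_diff[OF v _ c] by fastforce
  qed
  ultimately have hr: "h \<in> graded_reps v"
    using keys P_ge_0[OF v] by (force simp: graded_reps_def[OF v] h)
  have "graded_proj v p = graded_proj v (Poly_Mapping.single c g * h)"
    unfolding graded_proj_eq_iff lookup_single_mult[OF g]
    using q P_gt_0[OF v] by (simp add: h in_keys_iff)
  then have "graded_proj v p = graded_proj v h \<otimes>\<^bsub>graded_algebra v\<^esub> initial_form v g"
    using times[OF hr] by (simp add: m_comm initial_form_carrier[OF v] graded_proj_carrier[OF v hr])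
  then show "graded_proj v p \<in> PIdl\<^bsub>graded_algebra v\<^esub> (initial_form v g)"
    using graded_proj_carrier[OF v hr] by (auto simp: cgenideal_def)
qed

lemma initial_form_in_ideal_iff:
  assumes g: "v g = Fin c"
  shows "initial_form v f \<in> PIdl\<^bsub>graded_algebra v\<^esub> (initial_form v g) \<longleftrightarrow> val_dvd v g f"
proof (cases "v f")
  case (Fin a)
  have "(\<exists>q. f - g * q \<in> P_gt v a) \<longleftrightarrow> val_dvd v g f"
    by (simp add: val_dvd_def Fin P_gt_def)
  moreover have "\<exists>q. 0 - g * q \<in> P_gt v b" for b
    using P_gt_0[OF v] by (intro exI[of _ 0]) simp
  ultimately show ?thesis
    using value_group_base[OF v Fin]
    by (auto simp: initial_form_eq_proj[OF Fin] lookup_single when_def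
        graded_proj_in_ideal_iff[OF g single_in_graded_reps[OF Fin]])
next
  case Pinf
  interpret cring "graded_algebra v" by (rule graded_algebra_cring[OF v])
  have "\<zero>\<^bsub>graded_algebra v\<^esub> \<in> PIdl\<^bsub>graded_algebra v\<^esub> (initial_form v g)"
    using cgenideal_ideal[OF initial_form_carrier[OF v]]
    by (simp add: additive_subgroup.zero_closed ideal_def)
  with Pinf show ?thesis by (simp add: initial_form_infinite val_dvd_def)
qed (simp add: val_not_Minf[OF v])

lemma in_dvd_iff_in_ideal:
  "in_dvd v g f \<longleftrightarrow> initial_form v f \<in> PIdl\<^bsub>graded_algebra v\<^esub> (initial_form v g)"
proof -
  interpret cring "graded_algebra v" by (rule graded_algebra_cring[OF v])
  show ?thesis
    by (auto simp: in_dvd_def factor_def cgenideal_def initial_form_carrier[OF v] m_comm)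
qed

lemma in_dvd_iff: "v g = Fin c \<Longrightarrow> in_dvd v g f \<longleftrightarrow> val_dvd v g f"
  by (simp add: in_dvd_iff_in_ideal initial_form_in_ideal_iff)

lemma one_eq_initial_form: "\<one>\<^bsub>graded_algebra v\<^esub> = initial_form v 1"
  by (simp add: graded_algebra_def)

section \<open>MacLane--Vaquie key polynomials in terms of values\<close>

lemma KP_monic: "g \<in> KP v \<Longrightarrow> lead_coeff g = 1"
  by (simp add: KP_def)

lemma KP_finite:
  assumes "g \<in> KP v" obtains c where "v g = Fin c"
proof (cases "v g")
  case Pinf
  interpret cring "graded_algebra v" by (rule graded_algebra_cring[OF v])
  have "PIdl\<^bsub>graded_algebra v\<^esub> (initial_form v g) = {\<zero>\<^bsub>graded_algebra v\<^esub>}"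
    using Pinf by (auto simp: initial_form_infinite cgenideal_def intro!: exI[of _ "\<zero>\<^bsub>graded_algebra v\<^esub>"])
  with assms show thesis by (simp add: KP_def)
qed (use that val_not_Minf[OF v] in auto)

lemma KP_not_dvd_lower: "g \<in> KP v \<Longrightarrow> f \<noteq> 0 \<Longrightarrow> degree f < degree g \<Longrightarrow> \<not> val_dvd v g f"
  using in_dvd_iff KP_finite by (metis (mono_tags, lifting) KP_def mem_Collect_eq)

text \<open>
  Primality of the ideal, restricted to homogeneous elements; \<open>KP_I\<close> below is the converse.
\<close>

lemma KP_prime:
  assumes g: "g \<in> KP v" and dvd: "val_dvd v g (f * h)"
  shows "val_dvd v g f \<or> val_dvd v g h"
proof -
  obtain c where c: "v g = Fin c" using KP_finite[OF g] .
  have "primeideal (PIdl\<^bsub>graded_algebra v\<^esub> (initial_form v g)) (graded_algebra v)"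
    using g by (simp add: KP_def)
  from primeideal.I_prime[OF this initial_form_carrier[OF v] initial_form_carrier[OF v], of f h] dvd
  show ?thesis
    by (simp add: initial_form_mult[symmetric] initial_form_in_ideal_iff[OF c])
qed

lemma KP_not_unit:
  assumes g: "g \<in> KP v" shows "\<not> val_unit v g"
proof
  assume "val_unit v g"
  then obtain q where "Fin 0 < v (g * q - 1)" by (auto simp: val_unit_def)
  then have "Fin 0 < v (1 - g * q)" using val_diff_commute[OF v, of "g * q" 1] by simp
  then have "val_dvd v g 1" by (auto simp: val_dvd_def val_1[OF v])
  moreover obtain c where c: "v g = Fin c" using KP_finite[OF g] .
  ultimately have one: "\<one>\<^bsub>graded_algebra v\<^esub> \<in> PIdl\<^bsub>graded_algebra v\<^esub> (initial_form v g)"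
    by (simp add: one_eq_initial_form initial_form_in_ideal_iff)
  have prime: "primeideal (PIdl\<^bsub>graded_algebra v\<^esub> (initial_form v g)) (graded_algebra v)"
    using g by (simp add: KP_def)
  then have "PIdl\<^bsub>graded_algebra v\<^esub> (initial_form v g) = carrier (graded_algebra v)"
    using one by (intro ideal.one_imp_carrier) (simp_all add: primeideal_def)
  with primeideal.I_notcarr[OF prime] show False by simp
qed

lemma KP_nonconstant:
  assumes g: "g \<in> KP v" shows "0 < degree g"
proof (rule ccontr)
  assume "\<not> 0 < degree g"
  then obtain a where "g = [:a:]" by (auto elim: degree_eq_zeroE)
  with KP_monic[OF g] have "g = 1" by (simp add: one_pCons)
  then have "val_unit v g"
    unfolding val_unit_def by (intro exI[of _ 1]) (simp add: val_0[OF v])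
  with KP_not_unit[OF g] show False by simp
qed

lemma KP_finite_lower:
  assumes "g \<in> KP v" "f \<noteq> 0" "degree f < degree g" obtains a where "v f = Fin a"
  using KP_not_dvd_lower[OF assms] val_not_Minf[OF v, of f] that
  by (cases "v f") (auto simp: val_dvd_def)

text \<open>
  For a graded ideal primality can be tested on homogeneous elements: if neither of two elements lies
  in the ideal, multiply their components of least degree outside the ideal; all other contributions to
  the same degree of the product lie in the ideal. This uses that the value group is ordered.
\<close>

lemma KP_I:
  assumes monic: "lead_coeff g = 1" and c: "v g = Fin c"
    and prime: "\<And>f h. val_dvd v g (f * h) \<Longrightarrow> val_dvd v g f \<or> val_dvd v g h"
    and not_unit: "\<not> val_unit v g"
    and minimal: "\<And>f. f \<noteq> 0 \<Longrightarrow> degree f < degree g \<Longrightarrow> \<not> val_dvd v g f"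
  shows "g \<in> KP v"
proof -
  interpret cring "graded_algebra v" by (rule graded_algebra_cring[OF v])
  let ?I = "PIdl\<^bsub>graded_algebra v\<^esub> (initial_form v g)"
  define D where "D = (\<lambda>a f. \<exists>q. f - g * q \<in> P_gt v a)"
  have D_gt: "D a f" if "f \<in> P_gt v a" for a f
    using that unfolding D_def by (intro exI[of _ 0]) simp
  have D_add: "D a (f + h)" if "D a f" "D a h" for a f h
  proof -
    from that obtain q r where "f - g * q \<in> P_gt v a" "h - g * r \<in> P_gt v a" by (auto simp: D_def)
    from P_gt_add[OF v this] show ?thesis
      unfolding D_def by (intro exI[of _ "q + r"]) (simp add: algebra_simps)
  qed
  have D_minus: "D a (- f)" if "D a f" for a f
  proof -
    from that obtain q where "f - g * q \<in> P_gt v a" by (auto simp: D_def)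
    from P_gt_minus[OF v this] show ?thesis
      unfolding D_def by (intro exI[of _ "- q"]) simp
  qed
  have D_mult: "D (a + b) (f * h)" if "D a f" "h \<in> P_ge v b" for a b f h
  proof -
    from that obtain q where "f - g * q \<in> P_gt v a" by (auto simp: D_def)
    from P_gt_mult_left[OF v this that(2)] show ?thesis
      unfolding D_def by (intro exI[of _ "q * h"]) (simp add: algebra_simps)
  qed
  have D_sum: "D a (\<Sum>i\<in>A. f i)" if "\<And>i. i \<in> A \<Longrightarrow> D a (f i)" for a A and f :: "'g \<Rightarrow> 'k poly"
    using that
  proof (induction A rule: infinite_finite_induct)
    case (insert i A)
    then show ?case using D_add[of a "f i" "sum f A"] by simp
  qed (use D_gt[OF P_gt_0[OF v]] in simp_all)
  have D_prime: "D a f \<or> D b h" if "D (a + b) (f * h)" "f \<in> P_ge v a" "h \<in> P_ge v b" for a b f h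
  proof (cases "v f = Fin a \<and> v h = Fin b")
    case True
    then have "val_dvd v g (f * h)"
      using that(1) by (simp add: D_def val_dvd_def P_gt_def val_mult[OF v])
    from prime[OF this] show ?thesis using True by (simp add: D_def val_dvd_def P_gt_def)
  next
    case False
    then have "f \<in> P_gt v a \<or> h \<in> P_gt v b"
      using that(2,3) by (auto simp: P_ge_def P_gt_def order.order_iff_strict)
    then show ?thesis by (auto intro: D_gt)
  qed
  have "primeideal ?I (graded_algebra v)"
  proof (rule primeidealI)
    show "ideal ?I (graded_algebra v)" by (rule cgenideal_ideal[OF initial_form_carrier[OF v]])
    show "cring (graded_algebra v)" by (rule graded_algebra_cring[OF v])
    show "carrier (graded_algebra v) \<noteq> ?I"
    proof
      assume "carrier (graded_algebra v) = ?I"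
      then have "val_dvd v g 1"
        using initial_form_carrier[OF v, of 1] by (simp add: initial_form_in_ideal_iff[OF c])
      then obtain q where "Fin 0 < v (1 - g * q)" by (auto simp: val_dvd_def val_1[OF v])
      then have "val_unit v g"
        unfolding val_unit_def by (intro exI[of _ q]) (simp add: val_diff_commute[OF v, of "g * q" 1])
      with not_unit show False by simp
    qed
    fix F H
    assume F: "F \<in> carrier (graded_algebra v)" and H: "H \<in> carrier (graded_algebra v)"
      and FH: "F \<otimes>\<^bsub>graded_algebra v\<^esub> H \<in> ?I"
    obtain p where p: "p \<in> graded_reps v" "F = graded_proj v p" using graded_proj_surj[OF v F] .
    obtain r where r: "r \<in> graded_reps v" "H = graded_proj v r" using graded_proj_surj[OF v H] .
    have comp: "Poly_Mapping.lookup p a \<in> P_ge v a" "Poly_Mapping.lookup r a \<in> P_ge v a" for a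
      using p r by (auto simp: graded_reps_def[OF v])
    show "F \<in> ?I \<or> H \<in> ?I"
    proof (rule ccontr)
      let ?A = "\<lambda>p. {a \<in> Poly_Mapping.keys p. \<not> D a (Poly_Mapping.lookup p a)}"
      have least: "\<exists>a\<in>value_group v. \<not> D a (Poly_Mapping.lookup p a) \<and>
          (\<forall>b<a. D b (Poly_Mapping.lookup p b))"
        if p: "p \<in> graded_reps v" "graded_proj v p \<notin> ?I" for p
      proof -
        have z: "D b (Poly_Mapping.lookup p b)" if "b \<notin> ?A p" for b
        proof (cases "b \<in> Poly_Mapping.keys p")
          case False
          then have "Poly_Mapping.lookup p b = 0" by (simp add: in_keys_iff)
          then show ?thesis using D_gt[OF P_gt_0[OF v], of b] by simp
        qed (use that in blast)
        have fin: "finite (?A p)" by simp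
        have "?A p \<noteq> {}"
          using p(2) z unfolding graded_proj_in_ideal_iff[OF c p(1)] D_def by blast
        from Min_in[OF fin this] have m: "Min (?A p) \<in> ?A p" .
        have "D b (Poly_Mapping.lookup p b)" if "b < Min (?A p)" for b
        proof (rule z)
          show "b \<notin> ?A p" using Min_le[OF fin] that leD by blast
        qed
        moreover have "Min (?A p) \<in> value_group v"
          using m p(1) by (auto simp: graded_reps_def[OF v])
        ultimately show ?thesis using m by blast
      qed
      assume "\<not> (F \<in> ?I \<or> H \<in> ?I)"
      with least[OF p(1)] least[OF r(1)] p r obtain a b
        where a: "a \<in> value_group v" "\<not> D a (Poly_Mapping.lookup p a)"
            "\<And>a'. a' < a \<Longrightarrow> D a' (Poly_Mapping.lookup p a')"
          and b: "b \<in> value_group v" "\<not> D b (Poly_Mapping.lookup r b)"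
            "\<And>b'. b' < b \<Longrightarrow> D b' (Poly_Mapping.lookup r b')" by blast
      let ?t = "\<lambda>i. Poly_Mapping.lookup p i * Poly_Mapping.lookup r (a + b - i)"
      have "D (a + b) (Poly_Mapping.lookup (p * r) (a + b))"
        using FH p r graded_proj_in_ideal_iff[OF c graded_reps_mult[OF v p(1) r(1)]] a b
          value_group_add[OF v] by (simp add: D_def graded_proj_mult[OF v])
      then have total: "D (a + b) (sum ?t (Poly_Mapping.keys p))"
        by (simp add: lookup_mult_keys[OF v])
      have rest: "D (a + b) (?t i)" if "i \<noteq> a" for i
      proof (cases "i < a")
        case True
        have "i + (a + b - i) = a + b" by simp
        with D_mult[OF a(3)[OF True] comp(2)[of "a + b - i"]] show ?thesis by (simp only:)
      next
        case False
        with that have "a + b - i < b" by (simp add: algebra_simps)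
        moreover have "a + b - i + i = a + b" by simp
        ultimately show ?thesis
          using D_mult[OF b(3) comp(1)[of i], of "a + b - i"] by (simp only: mult.commute)
      qed
      have "a \<in> Poly_Mapping.keys p"
        using a(2) D_gt[OF P_gt_0[OF v]] by (auto simp: in_keys_iff)
      then have "?t a = sum ?t (Poly_Mapping.keys p) + - sum ?t (Poly_Mapping.keys p - {a})"
        by (simp add: sum_diff1)
      moreover have "D (a + b) (sum ?t (Poly_Mapping.keys p - {a}))"
        by (rule D_sum, rule rest) simp
      from D_add[OF total D_minus[OF this]]
      have "D (a + b) (sum ?t (Poly_Mapping.keys p) + - sum ?t (Poly_Mapping.keys p - {a}))" .
      ultimately have "D (a + b) (?t a)" by (simp only:)
      then have "D (a + b) (Poly_Mapping.lookup p a * Poly_Mapping.lookup r b)"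
        by (simp only: add_diff_cancel_left')
      from D_prime[OF this comp] a(2) b(2) show False by blast
    qed
  qed
  moreover have "?I \<noteq> {\<zero>\<^bsub>graded_algebra v\<^esub>}"
  proof
    assume "?I = {\<zero>\<^bsub>graded_algebra v\<^esub>}"
    then have "initial_form v g = \<zero>\<^bsub>graded_algebra v\<^esub>"
      using cgenideal_self[OF initial_form_carrier[OF v]] by blast
    then have "g +o P_gt v c = P_gt v c"
      using value_group_base[OF v c] c
      by (auto simp: initial_form_def graded_algebra_def dest!: fun_cong[of _ _ c])
    then have "g \<in> P_gt v c" by (simp only: coset_eq_zero_iff[OF v])
    then show False by (simp add: P_gt_def c)
  qed
  ultimately show ?thesis
    using monic minimal by (simp add: KP_def in_dvd_iff[OF c])
qed

end

section \<open>Division by a MacLane--Vaquie key polynomial\<close>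

context
  fixes v :: "'k::field poly \<Rightarrow> 'g::linordered_ab_group_add extended"
  assumes v: "is_valuation v"
begin

text \<open>
  If the remainder \<open>r\<close> had smaller value than the dividend, its initial form would be cancelled by that
  of \<open>g * q\<close>, and so be divisible by the initial form of \<open>g\<close>.
\<close>

lemma val_le_remainder:
  assumes "\<And>f. f \<noteq> 0 \<Longrightarrow> degree f < degree g \<Longrightarrow> \<not> val_dvd v g f" and "degree r < degree g"
  shows "v (g * q + r) \<le> v r"
proof (rule ccontr)
  assume "\<not> v (g * q + r) \<le> v r"
  then have less: "v r < v (r - g * (- q))" by (simp add: not_le add.commute)
  then have "r \<noteq> 0" using val_0[OF v] by auto
  moreover from less have "val_dvd v g r" unfolding val_dvd_def by blast
  ultimately show False using assms by blast
qed

lemma KP_val_le_mod: "g \<in> KP v \<Longrightarrow> v f \<le> v (f mod g)"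
  using val_le_remainder[of g "f mod g" "f div g"] KP_not_dvd_lower[OF v, of g] KP_nonconstant[OF v, of g]
    degree_mod_less[of g f]
  by fastforce

lemma KP_val_le_div: 
  assumes "g \<in> KP v" shows "v f \<le> v (f div g * g)"
proof -
  have "v f = min (v f) (v (f mod g))"
    using KP_val_le_mod[OF assms, of f] by (simp only: min_absorb1)
  also have "\<dots> \<le> v (f - f mod g)" by (rule val_diff[OF v])
  finally show ?thesis by (simp only: minus_mod_eq_div_mult)
qed

text \<open>
  No two parts of an expansion in powers of \<open>g\<close> cancel, so the valuation is its own truncation: it is
  determined by its values at \<open>g\<close> and below the degree of \<open>g\<close>.
\<close>

lemma KP_val_le_expansion:
  assumes g: "g \<in> KP v"
  shows "v f \<le> v (expansion_coeff g f s * g ^ s)"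
proof (induction s arbitrary: f)
  case 0
  show ?case using KP_val_le_mod[OF g, of f] by (simp add: expansion_coeff_def)
next
  case (Suc s)
  have e: "expansion_coeff g f (Suc s) = expansion_coeff g (f div g) s"
    by (simp add: expansion_coeff_def poly_div_mult_right)
  have "v f \<le> v (f div g) + v g"
    using KP_val_le_div[OF g, of f] by (simp add: val_mult[OF v])
  also have "\<dots> \<le> v (expansion_coeff g (f div g) s * g ^ s) + v g"
    by (intro add_right_mono Suc.IH)
  also have "\<dots> = v (expansion_coeff g f (Suc s) * g ^ Suc s)"
    by (simp add: e val_mult[OF v] ac_simps)
  finally show ?case .
qed

lemma truncation_KP:
  assumes g: "g \<in> KP v" shows "truncation v g = v"
proof
  fix f
  have "truncation v g f \<le> v (\<Sum>s\<le>degree f. expansion_coeff g f s * g ^ s)"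
    by (rule val_sum_ge[OF v]) (auto simp: truncation_def)
  then have "truncation v g f \<le> v f"
    using expansion_exists(3)[OF KP_nonconstant[OF v g], of f] by simp
  moreover have "v f \<le> truncation v g f"
    using KP_val_le_expansion[OF g] by (simp add: truncation_def)
  ultimately show "truncation v g f = v f" by (rule antisym)
qed

text \<open>
  A key polynomial is irreducible, since its initial form is prime and divides nothing of smaller
  degree. So it is coprime to \<open>a\<close>, and reducing \<open>b\<close> modulo \<open>g\<close> bounds both cofactors.
\<close>

lemma KP_bezout:
  assumes g: "g \<in> KP v" and a: "a \<noteq> 0" "degree a < degree g"
  obtains b c where "b * a + c * g = 1" "degree b < degree g" "degree c < degree g"
proof -
  have g0: "g \<noteq> 0" using KP_monic[OF v g] by auto
  \<comment> \<open>The combinations of least degree divide \<open>a\<close> and \<open>g\<close>, so they are constant.\<close>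
  let ?P = "\<lambda>d. d \<noteq> 0 \<and> (\<exists>x y. d = x * a + y * g)"
  have "a = 1 * a + 0 * g" by simp
  with a have "?P a" by blast
  then obtain d where d: "?P d" and least: "\<And>d'. ?P d' \<Longrightarrow> degree d \<le> degree d'"
    using ex_has_least_nat[of ?P a degree] by blast
  from d obtain x y where xy: "d = x * a + y * g" by blast
  have dvd: "d dvd x' * a + y' * g" for x' y'
  proof -
    let ?z = "x' * a + y' * g"
    have "?z mod d = (x' - ?z div d * x) * a + (y' - ?z div d * y) * g"
      using xy by (simp add: minus_div_mult_eq_mod[symmetric] algebra_simps)
    then have "?P (?z mod d)" if "?z mod d \<noteq> 0" using that by blast
    then have "?z mod d = 0"
      using least[of "?z mod d"] degree_mod_less'[of d ?z] d by force
    then show ?thesis by (simp add: dvd_eq_mod_eq_0)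
  qed
  from dvd[of 0 1] obtain e where e: "g = d * e" by (auto simp: dvd_def)
  have "d dvd a" using dvd[of 1 0] by simp
  then have "degree d \<le> degree a" using a by (intro dvd_imp_degree_le)
  then have dg: "degree d < degree g" using a by simp
  have "val_dvd v g (d * e)"
  proof -
    obtain c where "v g = Fin c" using KP_finite[OF v g] .
    then show ?thesis unfolding e[symmetric] val_dvd_def
      by (intro disjI2 exI[of _ 1]) (simp add: val_0[OF v])
  qed
  from KP_prime[OF v g this] have "val_dvd v g e"
    using KP_not_dvd_lower[OF v g _ dg] d by blast
  then have "\<not> degree e < degree g"
    using KP_not_dvd_lower[OF v g, of e] e g0 by auto
  moreover have "degree g = degree d + degree e"
    using e g0 by (auto simp: degree_mult_eq)
  ultimately have "degree d = 0" by simp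
  then obtain t where t: "d = [:t:]" by (auto elim: degree_eq_zeroE)
  with d have "t \<noteq> 0" by auto
  define x' where "x' = smult (inverse t) x"
  define b where "b = x' mod g"
  define c where "c = smult (inverse t) y + x' div g * a"
  have "smult (inverse t) d = 1" using t \<open>t \<noteq> 0\<close> by (simp add: one_pCons)
  then have "x' * a + smult (inverse t) y * g = 1"
    by (simp add: xy x'_def smult_add_right)
  moreover have "x' = x' div g * g + b" by (simp add: b_def)
  ultimately have "(x' div g * g + b) * a + smult (inverse t) y * g = 1" by simp
  then have bc: "b * a + c * g = 1" by (simp add: c_def algebra_simps)
  have b: "degree b < degree g"
    unfolding b_def using degree_mod_less[OF g0, of x'] KP_nonconstant[OF v g] by auto
  have "degree c < degree g"
  proof (cases "c = 0")
    case False
    have "c * g = 1 - b * a" using bc by (simp add: algebra_simps)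
    then have "degree (c * g) \<le> degree b + degree a"
      using degree_diff_le[of 1 "degree b + degree a" "b * a"] degree_mult_le[of b a] by simp
    moreover have "degree (c * g) = degree c + degree g"
      using False g0 by (rule degree_mult_eq)
    ultimately show ?thesis using b a by linarith
  qed (use KP_nonconstant[OF v g] in simp)
  with bc b show thesis by (rule that)
qed

section \<open>Polynomials of degree below the degree of the valuation\<close>

lemma val_unit_inverse_value:
  assumes "Fin 0 < v (f * g - 1)"
  shows "v (f * g) = Fin 0"
  using val_eq_of_diff[OF v, of 1 "f * g"] assms val_diff_commute[OF v, of "f * g" 1]
  by (simp add: val_1[OF v])

lemma val_unit_finite: "val_unit v f \<Longrightarrow> v f \<noteq> \<infinity>"
  using val_unit_inverse_value val_mult[OF v, of f] val_not_Minf[OF v]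
  unfolding val_unit_def by (metis extended.distinct(1) extended.exhaust plus_extended.simps(3,4))

lemma val_unit_of_dvd:
  assumes f: "val_unit v f" and dvd: "val_dvd v g f"
  shows "val_unit v g"
proof -
  obtain h where h: "Fin 0 < v (f * h - 1)" using f by (auto simp: val_unit_def)
  obtain q where q: "v f < v (f - g * q)"
    using dvd val_unit_finite[OF f] by (auto simp: val_dvd_def)
  have "v f + v h = Fin 0" using val_unit_inverse_value[OF h] by (simp add: val_mult[OF v])
  then have "Fin 0 < v ((f - g * q) * h)"
    unfolding val_mult[OF v, of "f - g * q"] by (rule extended_less_add[OF q])
  then have "min (v (f * h - 1)) (v ((f - g * q) * h)) > Fin 0" using h by simp
  also have "min (v (f * h - 1)) (v ((f - g * q) * h)) \<le> v ((f * h - 1) - (f - g * q) * h)"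
    by (rule val_diff[OF v])
  also have "(f * h - 1) - (f - g * q) * h = g * (q * h) - 1" by (simp add: algebra_simps)
  finally show ?thesis unfolding val_unit_def by blast
qed

lemma val_unit_mult:
  assumes "val_unit v f" "val_unit v g" shows "val_unit v (f * g)"
proof -
  obtain f' g' where h: "Fin 0 < v (f * f' - 1)" "Fin 0 < v (g * g' - 1)"
    using assms by (auto simp: val_unit_def)
  have "v ((f * f' - 1) * (g * g')) = v (f * f' - 1)"
    using val_unit_inverse_value[OF h(2)]
    by (cases "v (f * f' - 1)") (simp_all only: val_mult[OF v, of "f * f' - 1"], simp_all)
  then have "Fin 0 < min (v ((f * f' - 1) * (g * g'))) (v (g * g' - 1))" using h by simp
  also have "\<dots> \<le> v ((f * f' - 1) * (g * g') + (g * g' - 1))" by (rule val_add[OF v])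
  also have "(f * f' - 1) * (g * g') + (g * g' - 1) = (f * g) * (f' * g') - 1"
    by (simp add: algebra_simps)
  finally show ?thesis unfolding val_unit_def by blast
qed

text \<open>
  All non-zero remainders modulo \<open>g\<close> are units. If \<open>g\<close> divides neither \<open>f\<close> nor \<open>h\<close>, then the initial forms of
  \<open>f\<close> and \<open>h\<close> are those of their remainders modulo the ideal of \<open>g\<close>; if \<open>g\<close> divided \<open>f * h\<close>, it would
  divide a product of two units, and be a unit.
\<close>

lemma minimal_non_unit_in_KP:
  assumes monic: "lead_coeff g = 1" and fin: "v g \<noteq> \<infinity>" and g: "\<not> val_unit v g"
    and lower: "\<And>f. f \<noteq> 0 \<Longrightarrow> degree f < degree g \<Longrightarrow> val_unit v f"
  shows "g \<in> KP v"
proof -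
  obtain c where c: "v g = Fin c" using fin val_not_Minf[OF v] by (cases "v g") auto
  have not_dvd: "\<not> val_dvd v g f" if "val_unit v f" for f
    using val_unit_of_dvd[OF that] g by blast
  have minimal: "\<not> val_dvd v g f" if "f \<noteq> 0" "degree f < degree g" for f
    using not_dvd[OF lower[OF that]] .
  have "0 < degree g"
  proof (rule ccontr)
    assume "\<not> 0 < degree g"
    then obtain a where "g = [:a:]" by (auto elim: degree_eq_zeroE)
    with monic have "g = 1" by (simp add: one_pCons)
    then have "val_unit v g"
      unfolding val_unit_def by (intro exI[of _ 1]) (simp add: val_0[OF v])
    with g show False by simp
  qed
  then have deg_mod: "degree (f mod g) < degree g" for f
    using degree_mod_less[of g f] by (cases "g = 0") auto
  have remainder: "v (f mod g) = v f \<and> val_unit v (f mod g)" if "\<not> val_dvd v g f" for f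
  proof -
    have "v f \<le> v (f mod g)"
      using val_le_remainder[of g "f mod g" "f div g", OF minimal deg_mod] by simp
    moreover have "f - g * (f div g) = f mod g" by (simp add: minus_mult_div_eq_mod)
    ultimately have "v (f mod g) = v f"
      using that unfolding val_dvd_def by (metis order.order_iff_strict)
    moreover from this have "f mod g \<noteq> 0" using that by (auto simp: val_dvd_def val_0[OF v])
    ultimately show ?thesis using lower deg_mod by blast
  qed
  show ?thesis
  proof (rule KP_I[OF v monic c _ g minimal])
    fix f h assume fh: "val_dvd v g (f * h)"
    show "val_dvd v g f \<or> val_dvd v g h"
    proof (rule ccontr)
      assume "\<not> (val_dvd v g f \<or> val_dvd v g h)"
      then have r: "v (f mod g) = v f" "v (h mod g) = v h" and "val_unit v (f mod g * (h mod g))"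
        using remainder[of f] remainder[of h] val_unit_mult by auto
      moreover have "val_dvd v g (f mod g * (h mod g))"
      proof (cases "v (f * h) = \<infinity>")
        case True
        then show ?thesis using r by (simp add: val_dvd_def val_mult[OF v])
      next
        case False
        with fh obtain q where q: "v (f * h) < v (f * h - g * q)" by (auto simp: val_dvd_def)
        have "f mod g * (h mod g) - g * (q - (f div g * h + (f mod g) * (h div g))) = f * h - g * q"
          unfolding minus_mult_div_eq_mod[symmetric] by (simp add: algebra_simps)
        with q r show ?thesis unfolding val_dvd_def val_mult[OF v, of "f mod g"] val_mult[OF v, of f]
          by metis
      qed
      ultimately show False using not_dvd by blast
    qed
  qed
qed

text \<open>
  Otherwise a monic non-unit of least degree would be a key polynomial of degree below \<open>KP_degree v\<close>.
\<close>

lemma val_unit_below_KP_degree: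
  assumes g: "g \<in> KP v" and deg: "degree g = KP_degree v" and a: "a \<noteq> 0" "degree a < degree g"
  shows "val_unit v a"
proof (rule ccontr)
  let ?P = "\<lambda>f. f \<noteq> 0 \<and> degree f < degree g \<and> \<not> val_unit v f"
  assume "\<not> val_unit v a"
  with a have "?P a" by blast
  then obtain f where f: "?P f" and least: "\<And>f'. ?P f' \<Longrightarrow> degree f \<le> degree f'"
    using ex_has_least_nat[of ?P a degree] by blast
  define q where "q = smult (inverse (lead_coeff f)) f"
  have lc: "lead_coeff f \<noteq> 0" using f by simp
  then have dq: "degree q = degree f" and q0: "q \<noteq> 0" by (auto simp: q_def)
  have "lead_coeff q = 1" using lc by (simp add: q_def)
  moreover have "v q \<noteq> \<infinity>"
  proof -
    obtain b where "v q = Fin b"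
      using KP_finite_lower[OF v g q0] f dq by metis
    then show ?thesis by simp
  qed
  moreover have "\<not> val_unit v q"
  proof
    assume "val_unit v q"
    then obtain h where "Fin 0 < v (f * smult (inverse (lead_coeff f)) h - 1)"
      by (auto simp: val_unit_def q_def)
    with f show False unfolding val_unit_def by blast
  qed
  moreover have "val_unit v f'" if "f' \<noteq> 0" "degree f' < degree q" for f'
    using least[of f'] that f dq by fastforce
  ultimately have "q \<in> KP v" by (rule minimal_non_unit_in_KP)
  then have "KP_degree v \<le> degree q" unfolding KP_degree_def by (intro Least_le) auto
  with f dq deg show False by simp
qed

section \<open>Slopes\<close>

text \<open>
  A slope \<open>x / k\<close> of the divisible hull is handled by scaling \<open>v\<close> with \<open>k\<close>: comparing a quotient with
  \<open>x / k\<close> is comparing values of \<open>k v\<close> in the group itself.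
\<close>

lemma epsilon_term_le_iff:
  assumes f: "v f \<noteq> \<infinity>" and b: "b \<noteq> 0" and k: "k \<noteq> 0"
  shows "map_extended (\<lambda>a. dhull_frac a b) (v f - v (hasse b f)) \<le> Fin (dhull_frac x k) \<longleftrightarrow>
      nsmul k (v f) \<le> nsmul k (v (hasse b f)) + Fin (nsmul b x)" (is ?le)
    and "Fin (dhull_frac x k) \<le> map_extended (\<lambda>a. dhull_frac a b) (v f - v (hasse b f)) \<longleftrightarrow>
      nsmul k (v (hasse b f)) + Fin (nsmul b x) \<le> nsmul k (v f)" (is ?ge)
proof -
  obtain a where a: "v f = Fin a" using f val_not_Minf[OF v] by (cases "v f") auto
  have "?le \<and> ?ge"
  proof (cases "v (hasse b f)")
    case (Fin c)
    have "nsmul k (a - c) = nsmul k a - nsmul k c"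
      using nsmul_add[of k a "- c"] by (simp add: nsmul_minus)
    then show ?thesis using a Fin b k by (auto simp: dhull_frac_le_iff diff_le_eq le_diff_eq add.commute)
  qed (use a k val_not_Minf[OF v] in auto)
  then show ?le ?ge by auto
qed

lemma epsilon_le_iff:
  assumes f: "v f \<noteq> \<infinity>" "0 < degree f" and k: "k \<noteq> 0"
  shows "epsilon v f \<le> Fin (dhull_frac x k) \<longleftrightarrow>
    taylor_val (\<lambda>f. nsmul k (v f)) x f = nsmul k (v f)"
proof -
  let ?w = "\<lambda>f. nsmul k (v f)"
  have w: "is_valuation ?w" by (rule is_valuation_nsmul[OF v k])
  have "epsilon v f \<le> Fin (dhull_frac x k) \<longleftrightarrow>
      (\<forall>b\<in>{1..degree f}. ?w f \<le> ?w (hasse b f) + Fin (nsmul b x))"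
    using f epsilon_term_le_iff(1)[OF f(1) _ k] by (auto simp: epsilon_def Suc_le_eq)
  also have "\<dots> \<longleftrightarrow> (\<forall>b\<le>degree f. ?w f \<le> ?w (hasse b f) + Fin (nsmul b x))"
  proof -
    have "?w f \<le> ?w (hasse 0 f) + Fin (nsmul 0 x)" by (cases "?w f") auto
    then show ?thesis by (metis Suc_le_eq atLeastAtMost_iff One_nat_def neq0_conv)
  qed
  also have "\<dots> \<longleftrightarrow> ?w f \<le> taylor_val ?w x f" by (auto simp: taylor_val_def)
  also have "\<dots> \<longleftrightarrow> taylor_val ?w x f = ?w f"
    using taylor_val_le_val[OF w, of x f] by auto
  finally show ?thesis .
qed

lemma epsilon_ge_iff:
  assumes f: "v f \<noteq> \<infinity>" "0 < degree f" and k: "k \<noteq> 0"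
    and eq: "taylor_val (\<lambda>f. nsmul k (v f)) x f = nsmul k (v f)"
  shows "Fin (dhull_frac x k) \<le> epsilon v f \<longleftrightarrow> taylor_index (\<lambda>f. nsmul k (v f)) x f \<noteq> 0"
proof -
  let ?w = "\<lambda>f. nsmul k (v f)"
  have w: "is_valuation ?w" by (rule is_valuation_nsmul[OF v k])
  have "Fin (dhull_frac x k) \<le> epsilon v f \<longleftrightarrow>
      (\<exists>b\<in>{1..degree f}. ?w (hasse b f) + Fin (nsmul b x) \<le> ?w f)"
    using f epsilon_term_le_iff(2)[OF f(1) _ k] by (auto simp: epsilon_def Suc_le_eq Max_ge_iff)
  also have "\<dots> \<longleftrightarrow> (\<exists>b\<in>{1..degree f}. ?w (hasse b f) + Fin (nsmul b x) = taylor_val ?w x f)"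
    using taylor_val_le[OF w, of x f] eq by (metis order.eq_iff)
  also have "\<dots> \<longleftrightarrow> taylor_index ?w x f \<noteq> 0"
    using taylor_index_attained[OF w, of x f] taylor_index_ge[OF w, of _ f x]
    by (metis One_nat_def Suc_le_eq atLeastAtMost_iff le_zero_eq neq0_conv)
  finally show ?thesis .
qed

lemma epsilon_finite:
  assumes f: "v f \<noteq> \<infinity>" "0 < degree f"
  obtains x k where "k \<noteq> 0" "epsilon v f = Fin (dhull_frac x k)"
proof -
  let ?t = "\<lambda>b. map_extended (\<lambda>a. dhull_frac a b) (v f - v (hasse b f))"
  have eps: "epsilon v f = Max (?t ` {1..degree f})" using f by (simp add: epsilon_def)
  have "epsilon v f \<in> ?t ` {1..degree f}" unfolding eps using f by (intro Max_in) auto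
  then obtain b where b: "b \<in> {1..degree f}" "epsilon v f = ?t b" by auto
  obtain a where a: "v f = Fin a" using f val_not_Minf[OF v] by (cases "v f") auto
  have "v (hasse (degree f) f) \<noteq> \<infinity>"
    using f by (auto simp: hasse_degree val_const[OF v])
  then have "?t (degree f) \<noteq> -\<infinity>"
    using a val_not_Minf[OF v] by (cases "v (hasse (degree f) f)") auto
  moreover have "?t (degree f) \<le> epsilon v f" unfolding eps using f by (intro Max_ge) auto
  ultimately have "?t b \<noteq> -\<infinity>" using b by auto
  then obtain c where "v (hasse b f) = Fin c"
    using a val_not_Minf[OF v] by (cases "v (hasse b f)") auto
  with a b have "epsilon v f = Fin (dhull_frac (a - c) b)" by simp
  with b show thesis using that[of b "a - c"] by simp
qed

end

section \<open>Comparing two valuations\<close>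

context
  fixes u v :: "'k::field poly \<Rightarrow> 'g::linordered_ab_group_add extended"
  assumes u: "is_valuation u" and v: "is_valuation v" and le: "u \<le> v"
begin

text \<open>
  Two inequalities between factors whose products agree, and are finite, are equalities. This forces
  \<open>u\<close> and \<open>v\<close> to agree on constants and on all polynomials whose initial form for \<open>u\<close> is a unit.
\<close>

lemma val_eq_of_product_eq:
  assumes prod: "u (f * g) = v (f * g)" and fin: "v (f * g) = Fin c"
  shows "u f = v f"
proof -
  have f: "u f \<le> v f" and g: "u g \<le> v g" using le by (auto simp: le_fun_def)
  have cu: "u f + u g = Fin c" and cv: "v f + v g = Fin c"
    using prod fin by (simp_all add: val_mult[OF u] val_mult[OF v])
  have "\<not> u f < v f"
  proof
    assume "u f < v f"
    then have "Fin c < v f + u g" using cu by (rule extended_less_add)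
    also have "\<dots> \<le> v f + v g" using g by (rule add_left_mono)
    finally show False using cv by simp
  qed
  with f show ?thesis by simp
qed

lemma val_const_eq: "u [:c:] = v [:c:]"
proof (cases "c = 0")
  case False
  have "[:c:] * [:inverse c:] = 1" using False by (simp add: one_pCons)
  then show ?thesis
    using val_eq_of_product_eq[of "[:c:]" "[:inverse c:]" 0] by (simp add: val_1[OF u] val_1[OF v])
qed (simp add: val_0[OF u] val_0[OF v])

lemma unit_val_eq:
  assumes "val_unit u f" shows "u f = v f"
proof -
  obtain g where g: "Fin 0 < u (f * g - 1)" using assms by (auto simp: val_unit_def)
  also have "\<dots> \<le> v (f * g - 1)" using le by (simp add: le_fun_def)
  finally show ?thesis
    using val_eq_of_product_eq[of f g 0] val_unit_inverse_value[OF u g] val_unit_inverse_value[OF v]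
    by simp
qed

lemma Phi_val_eq_lower:
  assumes p: "p \<in> Phi u v" and f: "degree f < degree p"
  shows "u f = v f"
proof (cases "f = 0")
  case False
  define c where "c = [:inverse (lead_coeff f):]"
  have "lead_coeff (c * f) = 1" "degree (c * f) = degree f"
    using False by (simp_all add: c_def)
  moreover have "\<not> u q < v q" if "lead_coeff q = 1" "degree q < degree p" for q
    using p that by (auto simp: Phi_def not_less)
  ultimately have "\<not> u (c * f) < v (c * f)" using f by simp
  with le_funD[OF le, of "c * f"] have "u (c * f) = v (c * f)" by simp
  moreover obtain a where "v c = Fin a" unfolding c_def by (rule val_inverse_lead_coeff_finite[OF v False])
  moreover have "u c = v c" unfolding c_def by (rule val_const_eq)
  ultimately have "Fin a + u f = Fin a + v f"
    by (simp add: val_mult[OF u, of c] val_mult[OF v, of c])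
  then show ?thesis by (cases "u f"; cases "v f") auto
qed (simp add: val_0[OF u] val_0[OF v])

lemma val_eq_of_not_in_Phi:
  assumes "lead_coeff p = 1" "p \<notin> Phi u v" and lower: "\<And>f. degree f < degree p \<Longrightarrow> u f = v f"
  shows "u p = v p"
proof (rule ccontr)
  assume "u p \<noteq> v p"
  with le_funD[OF le, of p] have "u p < v p" by simp
  moreover have "degree p \<le> degree q" if "u q < v q" for q
    using lower[of q] that by (cases "degree q < degree p") auto
  ultimately show False using assms by (simp add: Phi_def)
qed

end

text \<open>
  Hasse derivatives of positive order lower the degree, so the slope of \<open>f\<close> only involves \<open>v f\<close> and
  values in degree below that of \<open>f\<close>.
\<close>

lemma epsilon_cong:
  assumes "u f = v f" and "\<And>g. degree g < degree f \<Longrightarrow> u g = v g"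
  shows "epsilon u f = epsilon v f"
proof -
  have "u (hasse b f) = v (hasse b f)" if "b \<in> {1..degree f}" for b
  proof (rule assms(2))
    have "degree f - b < degree f" using that by auto
    with degree_hasse[of b f] show "degree (hasse b f) < degree f" by (rule le_less_trans)
  qed
  then have "(\<lambda>b. map_extended (\<lambda>a. dhull_frac a b) (u f - u (hasse b f))) ` {1..degree f}
      = (\<lambda>b. map_extended (\<lambda>a. dhull_frac a b) (v f - v (hasse b f))) ` {1..degree f}"
    using assms(1) by (intro image_cong) simp_all
  then show ?thesis using assms(1) by (simp add: epsilon_def)
qed

lemma key_polynomial_cong:
  assumes "u p = v p" and lower: "\<And>g. degree g < degree p \<Longrightarrow> u g = v g"
  shows "key_polynomial u p \<longleftrightarrow> key_polynomial v p"
proof -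
  have "epsilon u p = epsilon v p" by (rule epsilon_cong) (use assms in auto)
  moreover have "epsilon u f = epsilon v f" if "degree f < degree p" for f
    by (rule epsilon_cong) (use lower that in auto)
  ultimately show ?thesis unfolding key_polynomial_def by auto
qed

section \<open>Key polynomials and units\<close>

context
  fixes v :: "'k::field poly \<Rightarrow> 'g::linordered_ab_group_add extended"
  assumes v: "is_valuation v"
begin

lemma key_polynomial_val_finite:
  assumes key: "key_polynomial v p" and f: "f \<noteq> 0" "degree f < degree p"
  shows "v f \<noteq> \<infinity>"
proof (cases "degree f = 0")
  case True
  then obtain c where "f = [:c:]" by (auto elim: degree_eq_zeroE)
  with f show ?thesis using val_const[OF v] by auto
next
  case False
  then have "epsilon v f < epsilon v p" using key f by (simp add: key_polynomial_def)
  then show ?thesis by (auto simp: epsilon_def)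
qed

text \<open>
  If \<open>v p\<close> is finite, then for the slope \<open>epsilon v p\<close> the polynomials \<open>a\<close> and \<open>b\<close> have index zero and \<open>p\<close> has positive index.
  So \<open>c * p\<close> has larger index than \<open>b * a\<close>, which forces its value to be larger; as the sum is \<open>1\<close>, the value
  of \<open>b * a\<close> is zero.
\<close>

lemma key_polynomial_bezout_pos:
  assumes key: "key_polynomial v p" and eq: "b * a + c * p = 1"
    and deg: "degree a < degree p" "degree b < degree p" "degree c < degree p"
  shows "Fin 0 < v (c * p)"
proof (cases "v p = \<infinity> \<or> c = 0")
  case True
  then have "v (c * p) = \<infinity>"
    using val_not_Minf[OF v, of c] val_not_Minf[OF v, of p]
    by (cases "v c"; cases "v p") (auto simp: val_mult[OF v] val_0[OF v])
  then show ?thesis by simp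
next
  case False
  then have p: "v p \<noteq> \<infinity>" "0 < degree p" and c: "c \<noteq> 0" using key by (auto simp: key_polynomial_def)
  have ba: "b * a \<noteq> 0"
  proof
    assume "b * a = 0"
    with eq have "c * p = 1" by simp
    moreover have "degree (c * p) = degree c + degree p"
      using c p by (intro degree_mult_eq) auto
    ultimately show False using p by simp
  qed
  obtain x k where k: "k \<noteq> 0" and e: "epsilon v p = Fin (dhull_frac x k)"
    using epsilon_finite[OF v p] .
  let ?w = "\<lambda>f. nsmul k (v f)"
  have w: "is_valuation ?w" by (rule is_valuation_nsmul[OF v k])
  have p_eq: "taylor_val ?w x p = ?w p"
    using epsilon_le_iff[OF v p k, of x] e by simp
  have p_ind: "taylor_index ?w x p \<noteq> 0"
    using epsilon_ge_iff[OF v p k p_eq] e by simp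
  have low: "taylor_val ?w x f = ?w f \<and> taylor_index ?w x f = 0" if f: "f \<noteq> 0" "degree f < degree p" for f
  proof (cases "degree f = 0")
    case True
    then show ?thesis
      using taylor_val_const[OF w, of f x] taylor_index_attained(1)[OF w, of x f] by simp
  next
    case False
    then have pos: "0 < degree f" by simp
    have fin: "v f \<noteq> \<infinity>" using key_polynomial_val_finite[OF key f] .
    have less: "epsilon v f < Fin (dhull_frac x k)"
      using key f pos e by (simp add: key_polynomial_def)
    then have eq: "taylor_val ?w x f = ?w f"
      using epsilon_le_iff[OF v fin pos k, of x] less_imp_le[OF less] by simp
    have "\<not> Fin (dhull_frac x k) \<le> epsilon v f" using less by (simp add: not_le)
    with eq show ?thesis using epsilon_ge_iff[OF v fin pos k eq] by simp
  qed
  have W: "is_valuation (taylor_val ?w x)" by (rule is_valuation_taylor_val[OF w])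
  have cp: "c * p \<noteq> 0" "taylor_index ?w x (c * p) \<noteq> 0" "taylor_val ?w x (c * p) = ?w (c * p)"
  proof -
    have p0: "p \<noteq> 0" using p by auto
    with c show "c * p \<noteq> 0" by simp
    show "taylor_index ?w x (c * p) \<noteq> 0"
      using taylor_index_mult[OF w c p0] p_ind by simp
    show "taylor_val ?w x (c * p) = ?w (c * p)"
      using low[OF c deg(3)] p_eq by (simp add: val_mult[OF W] val_mult[OF w])
  qed
  have ba': "taylor_index ?w x (b * a) = 0" "taylor_val ?w x (b * a) = ?w (b * a)"
    using ba low[of b] low[of a] deg
    by (simp_all add: taylor_index_mult[OF w] val_mult[OF W] val_mult[OF w])
  have "taylor_val ?w x (b * a) < taylor_val ?w x (c * p)"
    using taylor_val_le_of_sum_eq_1(2)[OF w eq cp(1,2) ba] ba' cp(2) by simp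
  then have "?w (b * a) < ?w (c * p)" using ba'(2) cp(3) by simp
  then have less: "v (b * a) < v (c * p)"
    using nsmul_extended_less_iff[OF k] val_not_Minf[OF v] by blast
  have "v (b * a) = v 1" using val_add_eq_left[OF v less] eq by simp
  with less show ?thesis by (simp add: val_1[OF v])
qed

text \<open>
  Suppose that \<open>q\<close> of smaller degree had slope at least that of \<open>p\<close>, and let \<open>W\<close> be the Taylor valuation of
  the slope of \<open>q\<close>; it agrees with \<open>v\<close> at \<open>p\<close> and \<open>q\<close>. If \<open>W\<close> differs from \<open>v\<close> somewhere below the degree of
  \<open>p\<close>, then dividing \<open>p\<close> by a polynomial \<open>g\<close> of least degree where it does shows that the initial form of \<open>p\<close>
  is that of its remainder, against \<open>irred\<close>. If it does not, then the values of the
  \<open>p\<close>-expansion of \<open>h\<close> are the same for both valuations, so \<open>h\<close> has positive value for \<open>W\<close>; but the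
  relation \<open>b * q - h = 1\<close>, where \<open>b * q\<close> has positive index, bounds that value by the value zero of \<open>b * q\<close>.
\<close>

lemma key_polynomial_criterion:
  assumes monic: "lead_coeff p = 1" and deg: "0 < degree p" and fin: "v p \<noteq> \<infinity>"
    and fin_lower: "\<And>f. f \<noteq> 0 \<Longrightarrow> degree f < degree p \<Longrightarrow> v f \<noteq> \<infinity>"
    and irred: "\<And>f q r. p = q * f + r \<Longrightarrow> degree f < degree p \<Longrightarrow> degree q < degree p \<Longrightarrow>
      degree r < degree p \<Longrightarrow> v (q * f) \<le> v p"
    and unit: "\<And>q. 0 < degree q \<Longrightarrow> degree q < degree p \<Longrightarrow>
      \<exists>b h. b * q = 1 + h \<and> (\<forall>s. Fin 0 < v (expansion_coeff p h s * p ^ s))"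
  shows "key_polynomial v p"
  unfolding key_polynomial_def
proof (intro conjI allI impI monic deg)
  fix q :: "'k poly" assume q: "0 < degree q \<and> degree q < degree p"
  show "epsilon v q < epsilon v p"
  proof (rule ccontr)
    assume "\<not> epsilon v q < epsilon v p"
    then have ge: "epsilon v p \<le> epsilon v q" by simp
    have q0: "q \<noteq> 0" and qdeg: "0 < degree q" using q by auto
    have qfin: "v q \<noteq> \<infinity>" using fin_lower q q0 by blast
    obtain x k where k: "k \<noteq> 0" and e: "epsilon v q = Fin (dhull_frac x k)"
      using epsilon_finite[OF v qfin qdeg] .
    let ?w = "\<lambda>f. nsmul k (v f)"
    let ?W = "taylor_val ?w x"
    have w: "is_valuation ?w" by (rule is_valuation_nsmul[OF v k])
    have W: "is_valuation ?W" by (rule is_valuation_taylor_val[OF w])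
    have W_le: "?W f \<le> ?w f" for f by (rule taylor_val_le_val[OF w])
    have p_eq: "?W p = ?w p" using epsilon_le_iff[OF v fin deg k, of x] ge e by simp
    have q_eq: "?W q = ?w q" using epsilon_le_iff[OF v qfin qdeg k, of x] e by simp
    have q_ind: "taylor_index ?w x q \<noteq> 0" using epsilon_ge_iff[OF v qfin qdeg k q_eq] e by simp
    have lower: "?W f = ?w f" if "degree f < degree p" for f
    proof (rule ccontr)
      let ?P = "\<lambda>f. degree f < degree p \<and> ?W f \<noteq> ?w f"
      assume "?W f \<noteq> ?w f"
      with that have "?P f" by blast
      then obtain g where g: "?P g" and least: "\<And>g'. ?P g' \<Longrightarrow> degree g \<le> degree g'"
        using ex_has_least_nat[of ?P f degree] by blast
      have gdeg: "degree g \<noteq> 0" using g taylor_val_const[OF w, of g x] by blast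
      then have g0: "g \<noteq> 0" by auto
      have g_less: "?W g < ?w g" using g W_le[of g] by (simp add: order.order_iff_strict)
      let ?d = "p div g" and ?r = "p mod g"
      have p_split: "p = ?d * g + ?r" by simp
      have rdeg: "degree ?r < degree g" using degree_mod_less[OF g0, of p] gdeg by auto
      have r_eq: "?W ?r = ?w ?r" using least[of ?r] rdeg g by (meson less_le_trans less_trans not_le)
      have d0: "?d \<noteq> 0"
      proof
        assume "?d = 0"
        with p_split have "?r = p" by simp
        with rdeg g show False by simp
      qed
      have "degree p = degree ?d + degree g"
      proof -
        have "degree p = degree (?d * g)"
          using degree_add_eq_left[of ?r "?d * g"] rdeg p_split d0 g0 by (simp add: degree_mult_eq)
        then show ?thesis using d0 g0 by (simp add: degree_mult_eq)
      qed
      then have ddeg: "degree ?d < degree p" using gdeg by simp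
      have dg_less: "?W (?d * g) < ?w (?d * g)"
      proof -
        obtain a where "?W ?d = Fin a" using taylor_val_finite[OF w d0] .
        then show ?thesis using W_le[of ?d] g_less
          by (cases "?w ?d"; cases "?W g"; cases "?w g")
            (auto simp: val_mult[OF W] val_mult[OF w] add_le_less_mono)
      qed
      \<comment> \<open>Otherwise the quotient part and the remainder would cancel for \<open>W\<close>, but for \<open>v\<close> the remainder
        alone has the least value.\<close>
      have "?W p \<le> ?W (?d * g)"
      proof (rule ccontr)
        assume "\<not> ?W p \<le> ?W (?d * g)"
        then have less: "?W (?d * g) < ?W p" by simp
        have "?W ?r = ?W (?d * g)"
          using val_diff_eq_left[OF W less] p_split val_diff_commute[OF W, of "?d * g" p]
          by (metis add_diff_cancel_left')
        then have "?w ?r < ?w (?d * g)" "?w ?r < ?W p" using r_eq dg_less less by simp_all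
        then have "?w p < ?W p" using val_add_eq_left[OF w, of ?r "?d * g"] p_split by (simp add: add.commute)
        with W_le[of p] show False by simp
      qed
      with dg_less p_eq have "?w p < ?w (?d * g)" by simp
      then have "v p < v (?d * g)" using nsmul_extended_less_iff[OF k] val_not_Minf[OF v] by blast
      moreover have "v (?d * g) \<le> v p"
        using irred[OF p_split _ ddeg] g rdeg by (meson less_trans)
      ultimately show False by simp
    qed
    obtain b h where bh: "b * q = 1 + h" and h: "\<And>s. Fin 0 < v (expansion_coeff p h s * p ^ s)"
      using unit q by blast
    have h_pos: "Fin 0 < ?W h"
    proof -
      have "Fin 0 < ?W (expansion_coeff p h s * p ^ s)" for s
      proof -
        have "?W (expansion_coeff p h s * p ^ s) = ?w (expansion_coeff p h s * p ^ s)"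
          using lower[OF expansion_exists(1)[OF deg]] p_eq
          by (simp add: val_mult[OF W] val_mult[OF w] val_power[OF W] val_power[OF w])
        then show ?thesis
          using h[of s] val_not_Minf[OF v, of "expansion_coeff p h s * p ^ s"]
            nsmul_extended_less_iff[OF k, of "Fin 0" "v (expansion_coeff p h s * p ^ s)"] by simp
      qed
      then have "Fin 0 < ?W (\<Sum>s\<le>degree h. expansion_coeff p h s * p ^ s)"
        by (intro val_sum_greater[OF W]) auto
      then show ?thesis using expansion_exists(3)[OF deg, of h] by simp
    qed
    have W1: "?W 1 = Fin 0" by (rule val_1[OF W])
    have bq: "?W (b * q) = Fin 0"
      using val_add_eq_left[OF W, of 1 h] h_pos bh W1 by simp
    then have b0: "b \<noteq> 0" by (auto simp: taylor_val_zero[OF w])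
    have "taylor_index ?w x (b * q) \<noteq> 0"
      using taylor_index_mult[OF w b0 q0] q_ind by simp
    moreover have "- h + b * q = 1" using bh by simp
    moreover have "b * q \<noteq> 0" using b0 q0 by simp
    ultimately have "?W (- h) \<le> ?W (b * q)" by (intro taylor_val_le_of_sum_eq_1(1)[OF w])
    with h_pos bq val_uminus[OF W, of h] show False by simp
  qed
qed

end

section \<open>The comparison theorem\<close>

text \<open>
  Both valuations agree below the degree of \<open>p\<close>. Here the error term of the criterion comes from a
  Bezout relation \<open>b * q + c * p = 1\<close>: primality of \<open>p\<close> for \<open>u\<close> makes \<open>u (c * p)\<close> non-negative, and \<open>v p\<close>
  exceeds \<open>u p\<close>. If the initial form of \<open>p\<close> for \<open>v\<close> were that of a polynomial \<open>r\<close> of smaller degree, with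
  the difference a product of polynomials of smaller degree, then \<open>u r = u p < v p = v r = u r\<close>.
\<close>

lemma key_polynomial_of_Phi:
  fixes u v :: "'k::field poly \<Rightarrow> 'g::linordered_ab_group_add extended"
  assumes u: "is_valuation u" and v: "is_valuation v" and le: "u \<le> v"
    and p: "p \<in> KP u" and Phi: "p \<in> Phi u v"
  shows "key_polynomial v p"
proof -
  have monic: "lead_coeff p = 1" by (rule KP_monic[OF u p])
  have deg: "0 < degree p" by (rule KP_nonconstant[OF u p])
  have lower: "u f = v f" if "degree f < degree p" for f
    by (rule Phi_val_eq_lower[OF u v le Phi that])
  have p_less: "u p < v p" using Phi by (simp add: Phi_def)
  have fin: "v f \<noteq> \<infinity>" if "f \<noteq> 0" "degree f < degree p" for f
    using KP_finite_lower[OF u p that] lower[OF that(2)] by (metis extended.distinct(1))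
  show ?thesis
  proof (cases "v p = \<infinity>")
    case True
    have "epsilon v f < epsilon v p" if "0 < degree f" "degree f < degree p" for f
    proof -
      have "v f \<noteq> \<infinity>" using fin[of f] that by fastforce
      from epsilon_finite[OF v this that(1)] obtain x k where "epsilon v f = Fin (dhull_frac x k)" .
      with True show ?thesis by (simp add: epsilon_def[of v p])
    qed
    with monic deg show ?thesis by (simp add: key_polynomial_def)
  next
    case False
    show ?thesis
    proof (rule key_polynomial_criterion[OF v monic deg False fin])
      fix f q r :: "'k poly"
      assume pe: "p = q * f + r" and d: "degree f < degree p" "degree q < degree p" "degree r < degree p"
      show "v (q * f) \<le> v p"
      proof (rule ccontr)
        assume "\<not> v (q * f) \<le> v p"
        then have less: "v p < v (q * f)" by simp
        have qf: "u (q * f) = v (q * f)" using d lower by (simp add: val_mult[OF u] val_mult[OF v])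
        have r: "r = p - q * f" using pe by simp
        have "v r = v p" unfolding r by (rule val_diff_eq_left[OF v less])
        moreover have "u r = u p"
          unfolding r by (rule val_diff_eq_left[OF u]) (use less p_less qf in simp)
        ultimately show False using lower[OF d(3)] p_less by simp
      qed
    next
      fix q :: "'k poly" assume q: "0 < degree q" "degree q < degree p"
      then have "q \<noteq> 0" by auto
      then obtain b c where bc: "b * q + c * p = 1" "degree b < degree p" "degree c < degree p"
        using KP_bezout[OF u p _ q(2)] by metis
      have e: "expansion_coeff p (- c * p) s = (if s = 1 then - c else 0)" for s
      proof (cases "s \<le> 1")
        case True
        have "expansion_coeff p (- c * p) s = (if s = 0 then 0 else - c)"
        proof (rule expansion_unique[OF _ _ True])
          show "- c * p = (\<Sum>s\<le>1. (if s = 0 then 0 else - c) * p ^ s)" by simp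
          show "degree (if s = 0 then 0 else - c) < degree p" for s using bc(3) deg by simp
        qed
        with True show ?thesis by auto
      next
        case False
        have "degree (- c * p) < degree (p ^ s)"
        proof -
          have "degree (- c * p) \<le> degree c + degree p" using degree_mult_le[of "- c" p] by simp
          also have "\<dots> < 2 * degree p" using bc(3) by simp
          also have "\<dots> \<le> s * degree p" using False by simp
          finally show ?thesis using deg degree_power_eq[of p s] by fastforce
        qed
        then show ?thesis using False by (simp add: expansion_coeff_def div_poly_less)
      qed
      have "Fin 0 < v (c * p)"
      proof (cases "c = 0")
        case False
        obtain a where a: "u c = Fin a" using KP_finite_lower[OF u p False bc(3)] .
        have "Fin 0 \<le> u (c * p)"
        proof (rule ccontr)
          assume "\<not> Fin 0 \<le> u (c * p)"
          then have less: "u (c * p) < u 1" by (simp add: val_1[OF u])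
          have bq: "b * q = - (c * p - 1)" using bc(1) by (simp add: algebra_simps)
          have "u (b * q) = u (c * p)"
            unfolding bq val_uminus[OF u] by (rule val_diff_eq_left[OF u less])
          moreover have "b * q - p * (- c) = 1" using bc(1) by (simp add: algebra_simps)
          ultimately have "val_dvd u p (b * q)"
            using less unfolding val_dvd_def by metis
          then have "val_dvd u p b \<or> val_dvd u p q" by (rule KP_prime[OF u p])
          moreover have "b \<noteq> 0" using bq less by (auto simp: val_0[OF u] val_uminus[OF u] dest: sym)
          ultimately show False
            using KP_not_dvd_lower[OF u p] bc(2) q \<open>q \<noteq> 0\<close> by blast
        qed
        also have "u (c * p) < v (c * p)"
          using p_less a lower[OF bc(3)]
          by (cases "u p"; cases "v p") (auto simp: val_mult[OF u] val_mult[OF v])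
        finally show ?thesis .
      qed (simp add: val_0[OF v])
      then have "Fin 0 < v (- c * p)" using val_uminus[OF v, of "c * p"] by simp
      then have "Fin 0 < v (expansion_coeff p (- c * p) s * p ^ s)" for s
        unfolding e by (simp add: val_0[OF v])
      moreover have "b * q = 1 + - c * p" using bc(1) by (simp add: algebra_simps)
      ultimately show "\<exists>b h. b * q = 1 + h \<and> (\<forall>s. Fin 0 < v (expansion_coeff p h s * p ^ s))"
        by blast
    qed
  qed
qed

text \<open>
  Below the degree of the valuation everything is a unit, which provides the \<open>b\<close> and \<open>h\<close> of the criterion;
  the expansion of \<open>h\<close> in powers of \<open>p\<close> has no term of smaller value than \<open>h\<close>.
\<close>

lemma key_polynomial_of_minimal_KP:
  fixes u :: "'k::field poly \<Rightarrow> 'g::linordered_ab_group_add extended"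
  assumes u: "is_valuation u" and p: "p \<in> KP u" and min: "degree p = KP_degree u"
  shows "key_polynomial u p"
proof -
  obtain c where c: "u p = Fin c" using KP_finite[OF u p] .
  show ?thesis
  proof (rule key_polynomial_criterion[OF u KP_monic[OF u p] KP_nonconstant[OF u p]])
    show "u p \<noteq> \<infinity>" using c by simp
    show "u f \<noteq> \<infinity>" if "f \<noteq> 0" "degree f < degree p" for f
      using KP_finite_lower[OF u p that] by (metis extended.distinct(1))
  next
    fix f q r :: "'k poly"
    assume pe: "p = q * f + r" and d: "degree r < degree p"
    show "u (q * f) \<le> u p"
    proof (rule ccontr)
      assume "\<not> u (q * f) \<le> u p"
      then have less: "u p < u (q * f)" by simp
      have r: "r = p - q * f" using pe by simp
      have ur: "u r = u p" unfolding r by (rule val_diff_eq_left[OF u less])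
      then have "r \<noteq> 0" using c by (auto simp: val_0[OF u])
      moreover have "val_dvd u p r"
        unfolding val_dvd_def using less ur pe val_uminus[OF u, of "q * f"]
        by (intro disjI2 exI[of _ 1]) simp
      ultimately show False using KP_not_dvd_lower[OF u p _ d] by blast
    qed
  next
    fix q :: "'k poly" assume q: "0 < degree q" "degree q < degree p"
    then have "q \<noteq> 0" by auto
    from val_unit_below_KP_degree[OF u p min this q(2)] obtain b where b: "Fin 0 < u (q * b - 1)"
      by (auto simp: val_unit_def)
    have "b * q = 1 + (q * b - 1)" by simp
    moreover have "Fin 0 < u (expansion_coeff p (q * b - 1) s * p ^ s)" for s
      using b KP_val_le_expansion[OF u p, of "q * b - 1" s] by (rule less_le_trans)
    ultimately show "\<exists>b h. b * q = 1 + h \<and> (\<forall>s. Fin 0 < u (expansion_coeff p h s * p ^ s))"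
      by blast
  qed
qed

text \<open>
  In the Bezout relation \<open>b * a + c * p = 1\<close> the product \<open>b * a\<close> has value zero for \<open>v\<close>. If its value for \<open>u\<close>
  were smaller, \<open>p\<close> would divide \<open>b * a\<close> for \<open>u\<close>, hence \<open>b\<close> or \<open>a\<close>, which have smaller degree.
\<close>

lemma key_polynomial_imp_val_eq_lower:
  fixes u v :: "'k::field poly \<Rightarrow> 'g::linordered_ab_group_add extended"
  assumes u: "is_valuation u" and v: "is_valuation v" and le: "u \<le> v"
    and p: "p \<in> KP u" and key: "key_polynomial v p" and a: "degree a < degree p"
  shows "u a = v a"
proof (cases "a = 0")
  case False
  obtain b c where bc: "b * a + c * p = 1" "degree b < degree p" "degree c < degree p"
    using KP_bezout[OF u p False a] .
  have pos: "Fin 0 < v (c * p)"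
    by (rule key_polynomial_bezout_pos[OF v key bc(1) a bc(2,3)])
  have ba: "b * a = 1 - c * p" using bc(1) by (simp add: algebra_simps)
  have v_ba: "v (b * a) = Fin 0"
    unfolding ba using val_diff_eq_left[OF v, of 1 "c * p"] pos by (simp add: val_1[OF v])
  have "u (b * a) = Fin 0"
  proof (rule ccontr)
    assume "u (b * a) \<noteq> Fin 0"
    moreover have "u (b * a) \<le> v (b * a)" using le by (simp add: le_fun_def)
    ultimately have less: "u (b * a) < Fin 0" using v_ba by simp
    have "b * a - p * (- c) = 1" using bc(1) by (simp add: algebra_simps)
    then have "u (b * a) < u (b * a - p * (- c))" using less by (simp only: val_1[OF u])
    then have "val_dvd u p (b * a)" unfolding val_dvd_def by blast
    then have "val_dvd u p b \<or> val_dvd u p a" by (rule KP_prime[OF u p])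
    moreover have "b \<noteq> 0" using v_ba by (auto simp: val_0[OF v])
    ultimately show False using KP_not_dvd_lower[OF u p] bc(2) a False by blast
  qed
  then show ?thesis
    using val_eq_of_product_eq[OF u v le, of a b 0] v_ba by (simp add: mult.commute)
qed (simp add: val_0[OF u] val_0[OF v])

text \<open>
  The Bezout relation makes every non-zero polynomial of smaller degree a unit, and no unit is a
  MacLane--Vaquie key polynomial.
\<close>

lemma key_polynomial_imp_minimal_KP:
  fixes u :: "'k::field poly \<Rightarrow> 'g::linordered_ab_group_add extended"
  assumes u: "is_valuation u" and p: "p \<in> KP u" and key: "key_polynomial u p"
  shows "degree p = KP_degree u"
proof -
  have "degree p \<le> degree q" if q: "q \<in> KP u" for q
  proof (rule ccontr)
    assume "\<not> degree p \<le> degree q"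
    then have less: "degree q < degree p" by simp
    have "q \<noteq> 0" using KP_monic[OF u q] by auto
    then obtain b c where bc: "b * q + c * p = 1" "degree b < degree p" "degree c < degree p"
      using KP_bezout[OF u p _ less] by metis
    have "Fin 0 < u (c * p)"
      by (rule key_polynomial_bezout_pos[OF u key bc(1) less bc(2,3)])
    moreover have "q * b - 1 = - (c * p)" using bc(1) by (simp add: algebra_simps)
    ultimately have "Fin 0 < u (q * b - 1)" by (simp only: val_uminus[OF u])
    then have "val_unit u q" unfolding val_unit_def by blast
    with KP_not_unit[OF u q] show False by blast
  qed
  then show ?thesis
    unfolding KP_degree_def using p by (intro Least_equality[symmetric]) auto
qed

lemma truncation_eq_augmentation:
  fixes u v :: "'k::field poly \<Rightarrow> 'g::linordered_ab_group_add extended"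
  assumes v: "is_valuation v" and deg: "0 < degree p"
    and lower: "\<And>f. degree f < degree p \<Longrightarrow> u f = v f"
  shows "truncation v p = augmentation u p (v p)"
proof
  fix f
  have "v (expansion_coeff p f s * p ^ s) = u (expansion_coeff p f s) + nsmul s (v p)" for s
    using lower[OF expansion_exists(1)[OF deg]] by (simp add: val_mult[OF v] val_power[OF v])
  then show "truncation v p f = augmentation u p (v p) f"
    by (simp add: truncation_def augmentation_def)
qed

theorem theorem2p17:
  fixes \<mu> \<nu> :: "'k::field poly \<Rightarrow> 'g::linordered_ab_group_add extended"
    and \<phi> :: "'k poly"
  assumes "is_valuation \<nu>" and "is_valuation \<mu>"
    and "\<forall>f a. \<mu> f = Fin a \<longrightarrow> a \<in> value_group \<nu>"
    and "\<mu> < \<nu>"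
    and "\<phi> \<in> KP \<mu>"
  shows "(key_polynomial \<nu> \<phi> \<longleftrightarrow>
      \<phi> \<in> Phi \<mu> \<nu> \<or> (\<phi> \<notin> Phi \<mu> \<nu> \<and> degree \<phi> = KP_degree \<mu>))
    \<and> (\<phi> \<in> Phi \<mu> \<nu> \<longrightarrow> truncation \<nu> \<phi> = augmentation \<mu> \<phi> (\<nu> \<phi>))
    \<and> (\<phi> \<notin> Phi \<mu> \<nu> \<and> degree \<phi> = KP_degree \<mu> \<longrightarrow> truncation \<nu> \<phi> = \<mu>)"
proof -
  note v = assms(1) and u = assms(2) and p = assms(5)
  have le: "\<mu> \<le> \<nu>" using assms(4) by simp
  note monic = KP_monic[OF u p] and deg = KP_nonconstant[OF u p]
  have minimal: "\<mu> \<phi> = \<nu> \<phi>" "\<And>f. degree f < degree \<phi> \<Longrightarrow> \<mu> f = \<nu> f"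
    if "\<phi> \<notin> Phi \<mu> \<nu>" "degree \<phi> = KP_degree \<mu>"
  proof -
    show lower: "\<mu> f = \<nu> f" if "degree f < degree \<phi>" for f
    proof (cases "f = 0")
      case False
      then show ?thesis
        using unit_val_eq[OF u v le] val_unit_below_KP_degree[OF u p _ False that]
          \<open>degree \<phi> = KP_degree \<mu>\<close> by blast
    qed (simp add: val_0[OF u] val_0[OF v])
    show "\<mu> \<phi> = \<nu> \<phi>"
      by (rule val_eq_of_not_in_Phi[OF u v le monic]) (use \<open>\<phi> \<notin> Phi \<mu> \<nu>\<close> lower in auto)
  qed
  have "key_polynomial \<nu> \<phi>" if "\<phi> \<notin> Phi \<mu> \<nu>" "degree \<phi> = KP_degree \<mu>"
    using key_polynomial_of_minimal_KP[OF u p that(2)] key_polynomial_cong[of \<mu> \<phi> \<nu>, OF minimal[OF that]]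
    by blast
  moreover have "degree \<phi> = KP_degree \<mu>" if key: "key_polynomial \<nu> \<phi>" and "\<phi> \<notin> Phi \<mu> \<nu>"
  proof -
    note lower = key_polynomial_imp_val_eq_lower[OF u v le p key]
    have "\<mu> \<phi> = \<nu> \<phi>"
      by (rule val_eq_of_not_in_Phi[OF u v le monic \<open>\<phi> \<notin> Phi \<mu> \<nu>\<close> lower])
    from key_polynomial_cong[of \<mu> \<phi> \<nu>, OF this lower] key have "key_polynomial \<mu> \<phi>" by blast
    then show ?thesis by (rule key_polynomial_imp_minimal_KP[OF u p])
  qed
  moreover have "key_polynomial \<nu> \<phi>" if "\<phi> \<in> Phi \<mu> \<nu>"
    by (rule key_polynomial_of_Phi[OF u v le p that])
  moreover have "truncation \<nu> \<phi> = augmentation \<mu> \<phi> (\<nu> \<phi>)" if "\<phi> \<in> Phi \<mu> \<nu>"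
    by (rule truncation_eq_augmentation[OF v deg Phi_val_eq_lower[OF u v le that]])
  moreover have "truncation \<nu> \<phi> = \<mu>" if "\<phi> \<notin> Phi \<mu> \<nu>" "degree \<phi> = KP_degree \<mu>"
  proof -
    have "truncation \<nu> \<phi> = augmentation \<mu> \<phi> (\<mu> \<phi>)"
      using truncation_eq_augmentation[OF v deg minimal(2)[OF that]] minimal(1)[OF that] by simp
    also have "\<dots> = truncation \<mu> \<phi>"
      by (rule truncation_eq_augmentation[OF u deg refl, symmetric])
    also have "\<dots> = \<mu>" by (rule truncation_KP[OF u p])
    finally show ?thesis .
  qed
  ultimately show ?thesis by blast
qed

end
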